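(* Let $k\ge 1$ and $m\ge 1$ be integers, and let $\mathcal{H}=(H_1,\ldots,H_m)$, where each $H_i$ is a finite nonempty $k$-uniform hypergraph. Let $H=\dot{\bigcup}_{i\in[m]}H_i$ be the multihypergraph that is the union of the $H_i$ counted with multiplicity, and let $L=L(H)$ be its line graph. If $|H_i|\ge k\,(deg_L(e)+1)$ for every $i\in[m]$ and every $e\in H_i$, then $(H_1,\ldots,H_m)$ has a system of disjoint representatives (SJR).
   Context: $[m]=\{1,\ldots,m\}$. A hypergraph is identified with its set of edges (nonempty sets of vertices, all hypergraphs being on a common vertex set); it is $k$-uniform if every edge has exactly $k$ vertices; $|H_i|$ is the number of edges of $H_i$. In the multiset union $\dot{\bigcup}_{i\in[m]}H_i$, an edge belonging to several of the $H_i$ appears once for each such $i$. The line graph $L(H)$ of a multihypergraph $H$ is the graph whose vertices are the edges of $H$ (with multiplicity), two distinct vertices being adjacent if the corresponding hyperedges intersect (in particular, distinct copies of the same hyperedge are adjacent). For $e\in H_i$, $deg_L(e)$ is the degree in $L$ of the vertex corresponding to the copy of $e$ coming from $H_i$. An SJR of $(H_1,\ldots,H_m)$ is a function $f:[m]\to\bigcup_{i\in[m]}H_i$ with $f(i)\in H_i$ for all $i$ and $f(i)\cap f(j)=\emptyset$ whenever $i\ne j$. *)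

theory Defs
  imports "Graph_Theory.Pair_Digraph"
begin

text \<open>
  A hypergraph is identified with its set of edges; the elements of the type \<open>'a\<close> are the
  potential vertices, so all hypergraphs of this type live on a common vertex set.
\<close>

definition hypergraph :: "'a set set \<Rightarrow> bool" where
  "hypergraph E \<longleftrightarrow> (\<forall>e\<in>E. e \<noteq> {})"

definition k_uniform :: "nat \<Rightarrow> 'a set set \<Rightarrow> bool" where
  "k_uniform k E \<longleftrightarrow> (\<forall>e\<in>E. finite e \<and> card e = k)"

text \<open>
  A multihypergraph is given by a set \<open>C\<close> of edge copies together with the map \<open>\<epsilon>\<close> that sends
  each copy to its underlying hyperedge. In the union with multiplicity of \<open>H 1, \<dots>, H m\<close> the
  copy of \<open>e\<close> that comes from \<open>H i\<close> is the pair \<open>(i, e)\<close>, and \<open>\<epsilon>\<close> is \<^const>\<open>snd\<close>.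
\<close>

definition multi_union :: "nat \<Rightarrow> (nat \<Rightarrow> 'a set set) \<Rightarrow> (nat \<times> 'a set) set" where
  "multi_union m H = (SIGMA i:{1..m}. H i)"

text \<open>
  As usual in this graph library, an undirected simple graph is a loop-free symmetric digraph;
  the edge between \<open>c\<close> and \<open>d\<close> is the pair of arcs \<open>(c, d)\<close> and \<open>(d, c)\<close>.
\<close>

definition line_graph :: "'c set \<Rightarrow> ('c \<Rightarrow> 'a set) \<Rightarrow> 'c pair_pre_digraph" where
  "line_graph C \<epsilon> =
     \<lparr> pverts = C, parcs = {(c, d). c \<in> C \<and> d \<in> C \<and> c \<noteq> d \<and> \<epsilon> c \<inter> \<epsilon> d \<noteq> {}} \<rparr>"

lemma pair_graph_line_graph:
  assumes "finite C"
  shows "pair_graph (line_graph C \<epsilon>)"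
proof -
  have "finite {(c, d). c \<in> C \<and> d \<in> C \<and> c \<noteq> d \<and> \<epsilon> c \<inter> \<epsilon> d \<noteq> {}}"
    by (rule finite_subset[of _ "C \<times> C"]) (use assms in auto)
  with assms show ?thesis
    by unfold_locales (auto simp: line_graph_def symmetric_def sym_def)
qed

text \<open>Every undirected edge at \<open>v\<close> contributes exactly one outgoing arc.\<close>

definition degree :: "'c pair_pre_digraph \<Rightarrow> 'c \<Rightarrow> nat" where
  "degree G v = out_degree (with_proj G) v"

lemma degree_line_graph:
  assumes "c \<in> C"
  shows "degree (line_graph C \<epsilon>) c = card {d \<in> C. d \<noteq> c \<and> \<epsilon> c \<inter> \<epsilon> d \<noteq> {}}"
proof -
  have "out_arcs (with_proj (line_graph C \<epsilon>)) c = Pair c ` {d \<in> C. d \<noteq> c \<and> \<epsilon> c \<inter> \<epsilon> d \<noteq> {}}"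
    using assms by (auto simp: out_arcs_def line_graph_def with_proj_def intro!: image_eqI)
  then show ?thesis
    by (simp add: degree_def out_degree_def card_image inj_on_def)
qed

definition is_SJR :: "nat \<Rightarrow> (nat \<Rightarrow> 'a set set) \<Rightarrow> (nat \<Rightarrow> 'a set) \<Rightarrow> bool" where
  "is_SJR m H f \<longleftrightarrow>
     (\<forall>i\<in>{1..m}. f i \<in> H i) \<and>
     (\<forall>i\<in>{1..m}. \<forall>j\<in>{1..m}. i \<noteq> j \<longrightarrow> f i \<inter> f j = {})"

end

theory Submission
  imports Defs "HOL-Library.Disjoint_Sets"
begin

text \<open>
  The weights \<open>w (i, e) = k / card (H i)\<close> form a fractional matching of total weight \<open>k * card I\<close>
  on the edges with colour in \<open>I\<close>. Whenever a subfamily carries a fractional matching of weight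
  larger than \<open>k * n\<close>, every real simplicial cycle on its matchings of size \<open>n\<close> is a boundary:
  the component of the cycle orthogonal to the boundaries is harmonic, and a Garland-type estimate,
  with hyperedges represented by their indicator vectors, shows that harmonic chains vanish.

  Exactness gives, by induction on \<open>card I\<close>, chains \<open>\<phi> I\<close> on matchings with colours in \<open>I\<close> whose
  boundary is the alternating sum of the \<open>\<phi> (I - {i})\<close>, as for the faces of a simplex. Pushing
  forward along the colouring, the number of rainbow matchings counted with coefficients in \<open>\<phi> I\<close>
  is \<open>1\<close>, so a rainbow matching exists.
\<close>

section \<open>Real linear algebra: antisymmetric double sums and weighted projection\<close>

lemma sum_antisym_zero:
  fixes f :: "'b \<Rightarrow> 'b \<Rightarrow> real"
  assumes "finite A" "\<And>u v. u \<in> A \<Longrightarrow> v \<in> A \<Longrightarrow> u \<noteq> v \<Longrightarrow> f u v = - f v u"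
  shows "(\<Sum>u\<in>A. \<Sum>v\<in>A - {u}. f u v) = 0"
proof -
  define g where "g u v = (if u = v then 0 else f u v)" for u v
  have eq: "(\<Sum>u\<in>A. \<Sum>v\<in>A - {u}. f u v) = (\<Sum>u\<in>A. \<Sum>v\<in>A. g u v)"
  proof (rule sum.cong[OF refl])
    show "(\<Sum>v\<in>A - {u}. f u v) = (\<Sum>v\<in>A. g u v)" for u
      by (rule sum.mono_neutral_cong_left) (use assms(1) in \<open>auto simp: g_def\<close>)
  qed
  have "(\<Sum>u\<in>A. \<Sum>v\<in>A. g u v) = (\<Sum>v\<in>A. \<Sum>u\<in>A. g u v)"
    by (rule sum.swap)
  also have "\<dots> = (\<Sum>v\<in>A. \<Sum>u\<in>A. - g v u)"
    by (intro sum.cong refl) (unfold g_def, metis assms(2) minus_zero)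
  also have "\<dots> = - (\<Sum>u\<in>A. \<Sum>v\<in>A. g u v)"
    by (simp add: sum_negf)
  finally show ?thesis using eq by simp
qed

text \<open>One Gram-Schmidt step per vector produces the normal equations for projecting
  \<open>z\<close> onto the span of the \<open>g t\<close>, in the inner product on \<open>S\<close>
  with weights \<open>\<mu>\<close>. Linear independence is not assumed: the \<open>g t\<close> will
  be boundaries of single matchings, which may be dependent.\<close>

lemma ex_weighted_projection:
  fixes g :: "'t \<Rightarrow> 's \<Rightarrow> real"
  assumes "finite T" "finite S" "\<And>s. s \<in> S \<Longrightarrow> \<mu> s > 0"
  shows "\<exists>y. \<forall>t\<in>T. (\<Sum>s\<in>S. \<mu> s * (z s - (\<Sum>t'\<in>T. y t' * g t' s)) * g t s) = 0"
  using assms(1)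
proof (induction T arbitrary: z rule: finite_induct)
  case empty
  then show ?case by simp
next
  case (insert t0 T)
  obtain a where a: "\<forall>t\<in>T. (\<Sum>s\<in>S. \<mu> s * (z s - (\<Sum>t'\<in>T. a t' * g t' s)) * g t s) = 0"
    using insert.IH by blast
  obtain b where b: "\<forall>t\<in>T. (\<Sum>s\<in>S. \<mu> s * (g t0 s - (\<Sum>t'\<in>T. b t' * g t' s)) * g t s) = 0"
    using insert.IH by blast
  define p where "p s = z s - (\<Sum>t'\<in>T. a t' * g t' s)" for s
  define q where "q s = g t0 s - (\<Sum>t'\<in>T. b t' * g t' s)" for s
  have pT: "(\<Sum>s\<in>S. \<mu> s * p s * g t s) = 0" and qT: "(\<Sum>s\<in>S. \<mu> s * q s * g t s) = 0"
    if "t \<in> T" for t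
    using a b that by (auto simp: p_def q_def)
  define Q where "Q = (\<Sum>s\<in>S. \<mu> s * q s * q s)"
  define c where "c = (\<Sum>s\<in>S. \<mu> s * p s * q s) / Q"
  \<comment> \<open>If \<open>Q = 0\<close>, then \<open>q\<close> vanishes on \<open>S\<close> and the junk value \<open>c = 0\<close> is the right one.\<close>
  have cQ: "(\<Sum>s\<in>S. \<mu> s * p s * q s) = c * Q"
  proof (cases "Q = 0")
    case True
    have "\<forall>s\<in>S. \<mu> s * q s * q s = 0"
      using True unfolding Q_def
      by (subst (asm) sum_nonneg_eq_0_iff)
         (use assms in \<open>auto simp: mult.assoc less_imp_le\<close>)
    then have "\<forall>s\<in>S. q s = 0"
      using assms(3) by force
    then show ?thesis using True by simp
  qed (simp add: c_def)
  \<comment> \<open>These coefficients express the residual \<open>p - c * q\<close> through the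
    original vectors: \<open>q\<close> contains \<open>g t0\<close> once and each old vector with
    coefficient \<open>- b t\<close>.\<close>
  define y where "y t = (if t = t0 then c else a t - c * b t)" for t
  have res: "z s - (\<Sum>t'\<in>insert t0 T. y t' * g t' s) = p s - c * q s" for s
  proof -
    have "(\<Sum>t'\<in>insert t0 T. y t' * g t' s)
        = c * g t0 s + (\<Sum>t'\<in>T. (a t' - c * b t') * g t' s)"
      using insert.hyps by (simp add: y_def) (intro sum.cong, auto)
    also have "\<dots> = c * g t0 s + ((\<Sum>t'\<in>T. a t' * g t' s) - c * (\<Sum>t'\<in>T. b t' * g t' s))"
      by (simp add: left_diff_distrib sum_subtractf sum_distrib_left mult.assoc)
    finally show ?thesis
      by (simp add: p_def q_def algebra_simps)
  qed
  have orthT: "(\<Sum>s\<in>S. \<mu> s * (p s - c * q s) * g t s) = 0" if "t \<in> T" for t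
  proof -
    have "(\<Sum>s\<in>S. \<mu> s * (p s - c * q s) * g t s)
        = (\<Sum>s\<in>S. \<mu> s * p s * g t s) - c * (\<Sum>s\<in>S. \<mu> s * q s * g t s)"
      by (simp add: sum_distrib_left flip: sum_subtractf) (simp add: algebra_simps)
    then show ?thesis using pT qT that by simp
  qed
  \<comment> \<open>Here \<open>g t0\<close> is \<open>q\<close> plus a combination of old vectors.
    The residual is orthogonal to the old vectors by \<open>orthT\<close> and to \<open>q\<close> by
    the choice of \<open>c\<close>.\<close>
  have "(\<Sum>s\<in>S. \<mu> s * (p s - c * q s) * g t0 s)
      = (\<Sum>s\<in>S. \<mu> s * p s * q s) - c * Q
        + (\<Sum>s\<in>S. \<Sum>t\<in>T. b t * (\<mu> s * (p s - c * q s) * g t s))"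
  proof -
    have g: "g t0 s = q s + (\<Sum>t\<in>T. b t * g t s)" for s by (simp add: q_def)
    show ?thesis
      unfolding Q_def g sum_distrib_left sum_subtractf[symmetric] sum.distrib[symmetric]
      by (intro sum.cong refl) (simp add: algebra_simps sum_distrib_left sum_subtractf)
  qed
  also have "\<dots> = (\<Sum>t\<in>T. b t * (\<Sum>s\<in>S. \<mu> s * (p s - c * q s) * g t s))"
    unfolding sum_distrib_left by (subst sum.swap) (simp add: cQ)
  also have "\<dots> = 0"
    using orthT by simp
  finally show ?case
    using orthT by (intro exI[of _ y]) (auto simp: res)
qed

section \<open>Signs, boundary and coboundary of real chains on finite sets\<close>

definition order_sign :: "('v \<Rightarrow> nat) \<Rightarrow> 'v \<Rightarrow> 'v set \<Rightarrow> real" where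
  "order_sign r v \<tau> = (-1) ^ card {x \<in> \<tau>. r x < r v}"

lemma order_sign_sq [simp]: "order_sign r v \<tau> * order_sign r v \<tau> = 1"
  by (simp add: order_sign_def flip: power_add)

lemma order_sign_sq_left [simp]: "order_sign r v \<tau> * (order_sign r v \<tau> * a) = a"
  by (simp flip: mult.assoc)

lemma order_sign_insert:
  assumes "finite \<tau>" "u \<notin> \<tau>"
  shows "order_sign r v (insert u \<tau>) = (if r u < r v then - order_sign r v \<tau> else order_sign r v \<tau>)"
proof -
  have "{x \<in> insert u \<tau>. r x < r v} =
      (if r u < r v then insert u {x \<in> \<tau>. r x < r v} else {x \<in> \<tau>. r x < r v})"
    by auto
  then show ?thesis using assms by (simp add: order_sign_def)
qed

text \<open>Exactly one of \<open>u\<close> and \<open>v\<close> comes first in the order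
  \<open>r\<close>. Inserting the earlier one flips the sign of the later one, and the other
  insertion changes nothing. This sign rule makes both squares below vanish.\<close>

lemma order_sign_swap:
  assumes "finite \<eta>" "u \<notin> \<eta>" "v \<notin> \<eta>" "r u \<noteq> r v"
  shows "order_sign r u \<eta> * order_sign r v (insert u \<eta>)
       = - (order_sign r v \<eta> * order_sign r u (insert v \<eta>))"
  using assms by (auto simp: order_sign_insert)

text \<open>Chains are real functions on unoriented sets; ordering vertices by \<open>r\<close>
  makes \<open>order_sign r v \<tau>\<close> the incidence number of the face \<open>\<tau>\<close>
  of \<open>insert v \<tau>\<close>. The empty set counts as a face, so this is the augmented
  complex.\<close>

definition boundary :: "('v \<Rightarrow> nat) \<Rightarrow> 'v set \<Rightarrow> ('v set \<Rightarrow> real) \<Rightarrow> 'v set \<Rightarrow> real" where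
  "boundary r V z \<tau> = (\<Sum>v\<in>V - \<tau>. order_sign r v \<tau> * z (insert v \<tau>))"

definition coboundary :: "('v \<Rightarrow> nat) \<Rightarrow> ('v set \<Rightarrow> real) \<Rightarrow> 'v set \<Rightarrow> real" where
  "coboundary r \<phi> \<rho> = (\<Sum>v\<in>\<rho>. order_sign r v (\<rho> - {v}) * \<phi> (\<rho> - {v}))"

lemma boundary_boundary:
  assumes "finite V" "finite \<tau>" "inj_on r V"
  shows "boundary r V (boundary r V z) \<tau> = 0"
proof -
  have "boundary r V (boundary r V z) \<tau> = (\<Sum>u\<in>V - \<tau>. \<Sum>v\<in>(V - \<tau>) - {u}.
      order_sign r u \<tau> * (order_sign r v (insert u \<tau>) * z (insert v (insert u \<tau>))))"
    unfolding boundary_def sum_distrib_left by (intro sum.cong refl) auto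
  also have "\<dots> = 0"
  proof (rule sum_antisym_zero)
    fix u v assume uv: "u \<in> V - \<tau>" "v \<in> V - \<tau>" "u \<noteq> v"
    then have "r u \<noteq> r v" using assms(3) by (auto dest: inj_onD)
    from order_sign_swap[of \<tau> u v r, OF assms(2) _ _ this] uv
    show "order_sign r u \<tau> * (order_sign r v (insert u \<tau>) * z (insert v (insert u \<tau>)))
       = - (order_sign r v \<tau> * (order_sign r u (insert v \<tau>) * z (insert u (insert v \<tau>))))"
      by (simp add: insert_commute flip: mult.assoc)
  qed (use assms in auto)
  finally show ?thesis .
qed

lemma coboundary_coboundary:
  assumes "finite \<rho>" "inj_on r \<rho>"
  shows "coboundary r (coboundary r \<phi>) \<rho> = 0"
proof -
  have "coboundary r (coboundary r \<phi>) \<rho> = (\<Sum>u\<in>\<rho>. \<Sum>v\<in>\<rho> - {u}.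
      order_sign r u (\<rho> - {u}) * (order_sign r v (\<rho> - {u} - {v}) * \<phi> (\<rho> - {u} - {v})))"
    unfolding coboundary_def sum_distrib_left by simp
  also have "\<dots> = 0"
  proof (rule sum_antisym_zero)
    fix u v assume uv: "u \<in> \<rho>" "v \<in> \<rho>" "u \<noteq> v"
    then have r: "r u \<noteq> r v" using assms(2) by (auto dest: inj_onD)
    define \<eta> where "\<eta> = \<rho> - {u} - {v}"
    have \<eta>: "\<rho> - {u} = insert v \<eta>" "\<rho> - {v} = insert u \<eta>" "\<rho> - {v} - {u} = \<eta>"
      "\<rho> - {u} - {v} = \<eta>" "u \<notin> \<eta>" "v \<notin> \<eta>" "finite \<eta>"
      using uv assms by (auto simp: \<eta>_def)
    have "order_sign r u (insert v \<eta>) * order_sign r v \<eta>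
        = - (order_sign r v (insert u \<eta>) * order_sign r u \<eta>)"
      using order_sign_swap[of \<eta> u v r] \<eta> r by (simp add: mult.commute)
    then show "order_sign r u (\<rho> - {u}) * (order_sign r v (\<rho> - {u} - {v}) * \<phi> (\<rho> - {u} - {v}))
       = - (order_sign r v (\<rho> - {v}) * (order_sign r u (\<rho> - {v} - {u}) * \<phi> (\<rho> - {v} - {u})))"
      unfolding \<eta>(3,4) unfolding \<eta>(1,2) by (simp flip: mult.assoc)
  qed (use assms in auto)
  finally show ?thesis .
qed

text \<open>The operators act on different arguments of a double chain: the boundary on
  \<open>\<sigma>\<close>, the coboundary on the index set. Hence the two finite sums can be
  exchanged.\<close>

lemma boundary_coboundary_commute:
  assumes "finite V"
  shows "boundary r V (\<lambda>\<sigma>. coboundary r' (\<lambda>J. \<phi> J \<sigma>) I) \<tau>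
       = coboundary r' (\<lambda>J. boundary r V (\<phi> J) \<tau>) I"
  unfolding boundary_def coboundary_def sum_distrib_left
  by (subst sum.swap) (simp add: algebra_simps)

lemma boundary_superset:
  assumes "finite V" "A \<subseteq> V" "\<And>\<sigma>. z \<sigma> \<noteq> 0 \<Longrightarrow> \<sigma> \<subseteq> A"
  shows "boundary r V z \<tau> = boundary r A z \<tau>"
  unfolding boundary_def
  by (rule sum.mono_neutral_right) (use assms in auto)

section \<open>The matching complex and an energy inequality for intersecting hyperedges\<close>

definition matchings :: "'v set \<Rightarrow> ('v \<Rightarrow> 'a set) \<Rightarrow> nat \<Rightarrow> 'v set set" where
  "matchings V \<epsilon> n = {\<sigma>. \<sigma> \<subseteq> V \<and> card \<sigma> = n \<and> disjoint_family_on \<epsilon> \<sigma>}"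

text \<open>Members of \<open>\<sigma>\<close> are excluded implicitly: a nonempty hyperedge meets
  itself (see \<open>insert_link\<close>).\<close>

definition link :: "'v set \<Rightarrow> ('v \<Rightarrow> 'a set) \<Rightarrow> 'v set \<Rightarrow> 'v set" where
  "link V \<epsilon> \<sigma> = {v \<in> V. \<forall>u\<in>\<sigma>. \<epsilon> u \<inter> \<epsilon> v = {}}"

text \<open>With \<open>x u = w u * a u\<close>, summing over all points the squared total of
  \<open>x\<close> on the hyperedges through the point shows that the form with matrix
  \<open>card (\<epsilon> u \<inter> \<epsilon> v)\<close> is nonnegative. Adding it to the left
  side leaves the factor \<open>card (\<epsilon> u \<inter> \<epsilon> v) - 1\<close>, which is
  nonnegative on intersecting pairs, so \<open>a u * a v\<close> may be replaced by the mean of the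
  squares; symmetry then merges the two halves.\<close>

lemma energy_estimate:
  fixes w a :: "'v \<Rightarrow> real" and \<epsilon> :: "'v \<Rightarrow> 'a set"
  assumes "finite L" "\<And>u. u \<in> L \<Longrightarrow> finite (\<epsilon> u)" "\<And>u. u \<in> L \<Longrightarrow> w u \<ge> 0"
  shows "- (\<Sum>u\<in>L. \<Sum>v\<in>L. if \<epsilon> u \<inter> \<epsilon> v = {} then 0 else w u * a u * (w v * a v))
    \<le> (\<Sum>u\<in>L. \<Sum>v\<in>L. if \<epsilon> u \<inter> \<epsilon> v = {} then 0
          else (real (card (\<epsilon> u \<inter> \<epsilon> v)) - 1) * w u * w v * (a u)\<^sup>2)"
proof -
  define M where "M u v = real (card (\<epsilon> u \<inter> \<epsilon> v))" for u v
  define G where "G u v = (if \<epsilon> u \<inter> \<epsilon> v = {} then 0 else (M u v - 1) * w u * w v)" for u v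
  define x where "x u = w u * a u" for u
  define P where "P = (\<Union>u\<in>L. \<epsilon> u)"
  have finP: "finite P" using assms by (auto simp: P_def)
  have "0 \<le> (\<Sum>p\<in>P. (\<Sum>u\<in>L. if p \<in> \<epsilon> u then x u else 0)\<^sup>2)"
    by (simp add: sum_nonneg)
  also have "\<dots> = (\<Sum>p\<in>P. \<Sum>u\<in>L. \<Sum>v\<in>L. if p \<in> \<epsilon> u \<inter> \<epsilon> v then x u * x v else 0)"
    by (simp add: power2_eq_square sum_product) (intro sum.cong refl, auto)
  also have "\<dots> = (\<Sum>u\<in>L. \<Sum>v\<in>L. \<Sum>p\<in>P. if p \<in> \<epsilon> u \<inter> \<epsilon> v then x u * x v else 0)"
    by (subst sum.swap) (intro sum.cong refl sum.swap)
  also have "\<dots> = (\<Sum>u\<in>L. \<Sum>v\<in>L. M u v * (x u * x v))"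
  proof (intro sum.cong refl)
    fix u v assume "u \<in> L" "v \<in> L"
    then have "P \<inter> (\<epsilon> u \<inter> \<epsilon> v) = \<epsilon> u \<inter> \<epsilon> v" by (auto simp: P_def)
    then show "(\<Sum>p\<in>P. if p \<in> \<epsilon> u \<inter> \<epsilon> v then x u * x v else 0) = M u v * (x u * x v)"
      using finP by (subst sum.inter_restrict[symmetric]) (auto simp: M_def)
  qed
  finally have psd: "0 \<le> (\<Sum>u\<in>L. \<Sum>v\<in>L. M u v * (x u * x v))" .
  have Gsym: "G u v = G v u" for u v
    by (simp add: G_def M_def Int_commute mult.commute mult.left_commute)
  have pt: "- (if \<epsilon> u \<inter> \<epsilon> v = {} then 0 else x u * x v)
      \<le> G u v * (((a u)\<^sup>2 + (a v)\<^sup>2) / 2) - M u v * (x u * x v)"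
    if uv: "u \<in> L" "v \<in> L" for u v
  proof (cases "\<epsilon> u \<inter> \<epsilon> v = {}")
    case False
    then have "M u v \<ge> 1"
      using assms(2)[OF uv(1)] by (simp add: M_def card_gt_0_iff Suc_le_eq)
    moreover have "a u * a v \<le> ((a u)\<^sup>2 + (a v)\<^sup>2) / 2"
      using sum_squares_bound[of "a u" "a v"] by simp
    ultimately have "((M u v - 1) * w u * w v) * (a u * a v)
        \<le> ((M u v - 1) * w u * w v) * (((a u)\<^sup>2 + (a v)\<^sup>2) / 2)"
      using assms(3) uv by (intro mult_left_mono) auto
    then show ?thesis using False by (simp add: G_def x_def algebra_simps)
  qed (simp add: G_def M_def)
  have "- (\<Sum>u\<in>L. \<Sum>v\<in>L. if \<epsilon> u \<inter> \<epsilon> v = {} then 0 else x u * x v)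
      \<le> (\<Sum>u\<in>L. \<Sum>v\<in>L. G u v * (((a u)\<^sup>2 + (a v)\<^sup>2) / 2) - M u v * (x u * x v))"
    unfolding sum_negf[symmetric] by (intro sum_mono pt)
  also have "\<dots> \<le> (\<Sum>u\<in>L. \<Sum>v\<in>L. G u v * (((a u)\<^sup>2 + (a v)\<^sup>2) / 2))"
    using psd by (simp add: sum_subtractf)
  also have "\<dots> = ((\<Sum>u\<in>L. \<Sum>v\<in>L. G u v * (a u)\<^sup>2) + (\<Sum>u\<in>L. \<Sum>v\<in>L. G u v * (a v)\<^sup>2)) / 2"
    by (simp add: sum.distrib[symmetric] sum_divide_distrib algebra_simps)
  also have "(\<Sum>u\<in>L. \<Sum>v\<in>L. G u v * (a v)\<^sup>2) = (\<Sum>u\<in>L. \<Sum>v\<in>L. G u v * (a u)\<^sup>2)"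
    by (subst sum.swap) (simp add: Gsym)
  finally show ?thesis
    unfolding x_def G_def M_def by (simp add: if_distrib[of "\<lambda>y. y * _"] cong: if_cong)
qed

section \<open>Harmonic chains on the matching complex\<close>

locale hyperedge_family =
  fixes V :: "'v set" and \<epsilon> :: "'v \<Rightarrow> 'a set" and r :: "'v \<Rightarrow> nat"
  assumes finite_V: "finite V"
    and finite_edge: "v \<in> V \<Longrightarrow> finite (\<epsilon> v)"
    and edge_nonempty: "v \<in> V \<Longrightarrow> \<epsilon> v \<noteq> {}"
    and inj_r: "inj_on r V"
begin

lemma finite_matchings: "finite (matchings V \<epsilon> n)"
  by (rule finite_subset[of _ "Pow V"]) (auto simp: matchings_def finite_V)

lemma matchings_finite: "\<sigma> \<in> matchings V \<epsilon> n \<Longrightarrow> finite \<sigma>"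
  using finite_V by (auto simp: matchings_def intro: finite_subset)

lemma finite_link: "finite (link V \<epsilon> \<sigma>)"
  by (simp add: link_def finite_V)

lemma insert_link:
  assumes "\<sigma> \<in> matchings V \<epsilon> n" "v \<in> link V \<epsilon> \<sigma>"
  shows "v \<notin> \<sigma>" "insert v \<sigma> \<in> matchings V \<epsilon> (Suc n)"
proof -
  show *: "v \<notin> \<sigma>" using assms edge_nonempty by (auto simp: link_def)
  show "insert v \<sigma> \<in> matchings V \<epsilon> (Suc n)"
    using assms matchings_finite[OF assms(1)] *
    by (auto simp: matchings_def link_def disjoint_family_on_def Int_commute)
qed

lemma remove_matching:
  assumes "\<rho> \<in> matchings V \<epsilon> (Suc n)" "v \<in> \<rho>"
  shows "\<rho> - {v} \<in> matchings V \<epsilon> n" "v \<in> link V \<epsilon> (\<rho> - {v})"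
  using assms matchings_finite[OF assms(1)]
  by (auto simp: matchings_def link_def disjoint_family_on_def)

text \<open>Both sides count pairs of a matching and one of its members. This localises a global sum
  to the links of the codimension-one faces, as in Garland's method.\<close>

lemma sum_matchings_Suc:
  fixes f :: "'v set \<Rightarrow> 'v \<Rightarrow> real"
  shows "(\<Sum>\<sigma>\<in>matchings V \<epsilon> (Suc n). \<Sum>u\<in>\<sigma>. f (\<sigma> - {u}) u)
       = (\<Sum>\<eta>\<in>matchings V \<epsilon> n. \<Sum>u\<in>link V \<epsilon> \<eta>. f \<eta> u)"
proof -
  have "(\<Sum>\<sigma>\<in>matchings V \<epsilon> (Suc n). \<Sum>u\<in>\<sigma>. f (\<sigma> - {u}) u)
      = (\<Sum>(\<sigma>, u)\<in>(SIGMA \<sigma>:matchings V \<epsilon> (Suc n). \<sigma>). f (\<sigma> - {u}) u)"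
    by (rule sum.Sigma) (auto intro: finite_matchings matchings_finite)
  also have "\<dots> = (\<Sum>(\<eta>, u)\<in>(SIGMA \<eta>:matchings V \<epsilon> n. link V \<epsilon> \<eta>). f \<eta> u)"
    by (rule sum.reindex_bij_witness[of _ "\<lambda>(\<eta>, u). (insert u \<eta>, u)" "\<lambda>(\<sigma>, u). (\<sigma> - {u}, u)"])
       (auto simp: insert_absorb insert_link remove_matching)
  also have "\<dots> = (\<Sum>\<eta>\<in>matchings V \<epsilon> n. \<Sum>u\<in>link V \<epsilon> \<eta>. f \<eta> u)"
    by (rule sum.Sigma[symmetric]) (auto intro: finite_matchings finite_link)
  finally show ?thesis .
qed

lemma boundary_outside_matchings:
  assumes "\<And>\<sigma>. z \<sigma> \<noteq> 0 \<Longrightarrow> \<sigma> \<in> matchings V \<epsilon> (Suc n)" "\<tau> \<notin> matchings V \<epsilon> n"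
  shows "boundary r V z \<tau> = 0"
  unfolding boundary_def
proof (intro sum.neutral ballI)
  fix v assume v: "v \<in> V - \<tau>"
  have "z (insert v \<tau>) = 0"
  proof (rule ccontr)
    assume "z (insert v \<tau>) \<noteq> 0"
    then have "insert v \<tau> - {v} \<in> matchings V \<epsilon> n"
      by (intro remove_matching[where n = n] assms) auto
    with v assms(2) show False by simp
  qed
  then show "order_sign r v \<tau> * z (insert v \<tau>) = 0" by simp
qed

lemma boundary_eq_sum_link:
  assumes "\<And>\<sigma>. z \<sigma> \<noteq> 0 \<Longrightarrow> \<sigma> \<in> matchings V \<epsilon> (Suc n)" "\<tau> \<in> matchings V \<epsilon> n"
  shows "boundary r V z \<tau> = (\<Sum>v\<in>link V \<epsilon> \<tau>. order_sign r v \<tau> * z (insert v \<tau>))"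
  unfolding boundary_def
proof (rule sum.mono_neutral_right)
  show "link V \<epsilon> \<tau> \<subseteq> V - \<tau>" using insert_link[OF assms(2)] by (auto simp: link_def)
  show "\<forall>v\<in>V - \<tau> - link V \<epsilon> \<tau>. order_sign r v \<tau> * z (insert v \<tau>) = 0"
  proof
    fix v assume v: "v \<in> V - \<tau> - link V \<epsilon> \<tau>"
    have "z (insert v \<tau>) = 0"
    proof (rule ccontr)
      assume "z (insert v \<tau>) \<noteq> 0"
      then have "v \<in> link V \<epsilon> (insert v \<tau> - {v})"
        by (intro remove_matching[where n = n] assms) auto
      with v show False by simp
    qed
    then show "order_sign r v \<tau> * z (insert v \<tau>) = 0" by simp
  qed
qed (use finite_V in auto)

text \<open>For \<open>v\<close> in the link, the cocycle condition on
  \<open>insert v \<sigma>\<close> expresses \<open>\<phi> \<sigma>\<close> by the values at the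
  matchings where some \<open>u\<close> is exchanged for \<open>v\<close>. Averaging over
  \<open>v\<close> with weights \<open>w\<close>, the cycle condition replaces the \<open>v\<close>
  disjoint from \<open>u\<close> by those that meet \<open>u\<close>.\<close>

lemma harmonic_pointwise:
  assumes \<sigma>: "\<sigma> \<in> matchings V \<epsilon> n"
    and cocycle: "\<And>\<rho>. \<rho> \<in> matchings V \<epsilon> (Suc n) \<Longrightarrow> coboundary r \<phi> \<rho> = 0"
    and cycle: "\<And>u. u \<in> \<sigma> \<Longrightarrow> (\<Sum>v\<in>link V \<epsilon> (\<sigma> - {u}).
      w v * (order_sign r v (\<sigma> - {u}) * \<phi> (insert v (\<sigma> - {u})))) = 0"
  shows "sum w (link V \<epsilon> \<sigma>) * \<phi> \<sigma> =
    - (\<Sum>u\<in>\<sigma>. order_sign r u (\<sigma> - {u}) * (\<Sum>v\<in>link V \<epsilon> (\<sigma> - {u}).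
        if \<epsilon> u \<inter> \<epsilon> v = {} then 0
        else w v * (order_sign r v (\<sigma> - {u}) * \<phi> (insert v (\<sigma> - {u})))))"
proof -
  note fin\<sigma> = matchings_finite[OF \<sigma>]
  have \<sigma>V: "\<sigma> \<subseteq> V" using \<sigma> by (auto simp: matchings_def)
  define t where "t u v = w v * (order_sign r v (\<sigma> - {u}) * \<phi> (insert v (\<sigma> - {u})))" for u v
  have exchange: "w v * \<phi> \<sigma> = (\<Sum>u\<in>\<sigma>. order_sign r u (\<sigma> - {u}) * t u v)"
    if v: "v \<in> link V \<epsilon> \<sigma>" for v
  proof -
    have v\<sigma>: "v \<notin> \<sigma>" and vV: "v \<in> V" using insert_link[OF \<sigma> v] v by (auto simp: link_def)
    have "0 = coboundary r \<phi> (insert v \<sigma>)"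
      using cocycle insert_link[OF \<sigma> v] by simp
    also have "\<dots> = order_sign r v \<sigma> * \<phi> \<sigma>
        + (\<Sum>u\<in>\<sigma>. order_sign r u (insert v (\<sigma> - {u})) * \<phi> (insert v (\<sigma> - {u})))"
      unfolding coboundary_def using fin\<sigma> v\<sigma>
      by (auto intro!: sum.cong simp: insert_Diff_if)
    finally have "order_sign r v \<sigma> * \<phi> \<sigma>
        = - (\<Sum>u\<in>\<sigma>. order_sign r u (insert v (\<sigma> - {u})) * \<phi> (insert v (\<sigma> - {u})))"
      by simp
    then have "w v * (order_sign r v \<sigma> * (order_sign r v \<sigma> * \<phi> \<sigma>)) = w v * (order_sign r v \<sigma> *
        - (\<Sum>u\<in>\<sigma>. order_sign r u (insert v (\<sigma> - {u})) * \<phi> (insert v (\<sigma> - {u}))))"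
      by simp
    then have "w v * \<phi> \<sigma> = (\<Sum>u\<in>\<sigma>. w v * (- (order_sign r v \<sigma> *
        order_sign r u (insert v (\<sigma> - {u})))) * \<phi> (insert v (\<sigma> - {u})))"
      by (simp add: sum_distrib_left sum_negf mult.assoc)
    also have "\<dots> = (\<Sum>u\<in>\<sigma>. order_sign r u (\<sigma> - {u}) * t u v)"
    proof (rule sum.cong[OF refl])
      fix u assume u: "u \<in> \<sigma>"
      define \<eta> where "\<eta> = \<sigma> - {u}"
      have \<eta>: "\<sigma> = insert u \<eta>" "finite \<eta>" "u \<notin> \<eta>" "v \<notin> \<eta>"
        using u fin\<sigma> v\<sigma> by (auto simp: \<eta>_def)
      \<comment> \<open>Dropping \<open>u\<close> from the sign of \<open>v\<close> and
        \<open>v\<close> from the sign of \<open>u\<close> costs one minus sign in total, because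
        exactly one of them precedes the other.\<close>
      have "r u \<noteq> r v" using inj_r u \<sigma>V vV v\<sigma> by (auto dest: inj_onD)
      then have "- (order_sign r v \<sigma> * order_sign r u (insert v \<eta>))
          = order_sign r u \<eta> * order_sign r v \<eta>"
        unfolding \<eta>(1) using \<eta>(2-) by (auto simp: order_sign_insert)
      then show "w v * (- (order_sign r v \<sigma> *
        order_sign r u (insert v (\<sigma> - {u})))) * \<phi> (insert v (\<sigma> - {u})) = order_sign r u (\<sigma> - {u}) * t u v"
        unfolding t_def \<eta>_def[symmetric] by simp
    qed
    finally show ?thesis .
  qed
  \<comment> \<open>The link of \<open>\<sigma>\<close> is the part of the link of
    \<open>\<sigma> - {u}\<close> disjoint from \<open>\<epsilon> u\<close>. The sum over the larger
    link is zero, so the complementary part, which contains \<open>u\<close> itself, gives the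
    negative.\<close>
  have inner: "(\<Sum>v\<in>link V \<epsilon> \<sigma>. t u v)
      = - (\<Sum>v\<in>link V \<epsilon> (\<sigma> - {u}). if \<epsilon> u \<inter> \<epsilon> v = {} then 0 else t u v)" if u: "u \<in> \<sigma>" for u
  proof -
    let ?L = "link V \<epsilon> (\<sigma> - {u})"
    have "link V \<epsilon> \<sigma> = {v \<in> ?L. \<epsilon> u \<inter> \<epsilon> v = {}}" using u by (auto simp: link_def)
    then have "(\<Sum>v\<in>link V \<epsilon> \<sigma>. t u v) = (\<Sum>v\<in>?L. if \<epsilon> u \<inter> \<epsilon> v = {} then t u v else 0)"
      by (simp only: sum.inter_filter[OF finite_link])
    also have "\<dots> = (\<Sum>v\<in>?L. t u v - (if \<epsilon> u \<inter> \<epsilon> v = {} then 0 else t u v))"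
      by (intro sum.cong) auto
    also have "\<dots> = - (\<Sum>v\<in>?L. if \<epsilon> u \<inter> \<epsilon> v = {} then 0 else t u v)"
      using cycle[OF u] by (simp add: sum_subtractf t_def)
    finally show ?thesis .
  qed
  have "sum w (link V \<epsilon> \<sigma>) * \<phi> \<sigma>
      = (\<Sum>v\<in>link V \<epsilon> \<sigma>. \<Sum>u\<in>\<sigma>. order_sign r u (\<sigma> - {u}) * t u v)"
    by (simp add: sum_distrib_right exchange)
  also have "\<dots> = (\<Sum>u\<in>\<sigma>. order_sign r u (\<sigma> - {u}) * (\<Sum>v\<in>link V \<epsilon> \<sigma>. t u v))"
    by (subst sum.swap) (simp add: sum_distrib_left)
  also have "\<dots> = - (\<Sum>u\<in>\<sigma>. order_sign r u (\<sigma> - {u}) *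
      (\<Sum>v\<in>link V \<epsilon> (\<sigma> - {u}). if \<epsilon> u \<inter> \<epsilon> v = {} then 0 else t u v))"
    unfolding sum_negf[symmetric] by (intro sum.cong refl) (simp add: inner)
  finally show ?thesis unfolding t_def .
qed

text \<open>Each of the \<open>n\<close> hyperedges has \<open>k\<close> points, and each point
  carries weight at most 1, so the weight meeting \<open>\<sigma>\<close>, counted with intersection
  sizes, is at most \<open>k * n\<close>. A hyperedge outside the link is counted at least once; if
  it meets only one \<open>u\<close>, the excess over 1 is exactly the correction term of
  \<open>energy_estimate\<close>.\<close>

lemma link_weight_bound:
  fixes w :: "'v \<Rightarrow> real"
  assumes \<sigma>: "\<sigma> \<in> matchings V \<epsilon> n"
    and w_nonneg: "\<And>v. v \<in> V \<Longrightarrow> w v \<ge> 0"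
    and uniform: "\<And>v. v \<in> V \<Longrightarrow> card (\<epsilon> v) = k"
    and fractional: "\<And>x. (\<Sum>v | v \<in> V \<and> x \<in> \<epsilon> v. w v) \<le> 1"
  shows "sum w V - real (k * n) \<le> sum w (link V \<epsilon> \<sigma>)
    - (\<Sum>u\<in>\<sigma>. \<Sum>v\<in>link V \<epsilon> (\<sigma> - {u}).
        if \<epsilon> u \<inter> \<epsilon> v = {} then 0 else (real (card (\<epsilon> u \<inter> \<epsilon> v)) - 1) * w v)"
proof -
  note fin\<sigma> = matchings_finite[OF \<sigma>]
  have \<sigma>V: "\<sigma> \<subseteq> V" and card\<sigma>: "card \<sigma> = n" using \<sigma> by (auto simp: matchings_def)
  define M where "M u v = real (card (\<epsilon> u \<inter> \<epsilon> v))" for u v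
  define N where "N u v = (if v \<notin> link V \<epsilon> (\<sigma> - {u}) \<or> \<epsilon> u \<inter> \<epsilon> v = {} then 0 else M u v - 1)"
    for u v
  have M_ge: "M u v \<ge> 1" if "u \<in> V" "\<epsilon> u \<inter> \<epsilon> v \<noteq> {}" for u v
    using finite_edge[OF that(1)] that(2) by (simp add: M_def card_gt_0_iff Suc_le_eq)
  have M_nonneg: "M u v \<ge> 0" for u v by (simp add: M_def)
  \<comment> \<open>\<open>N u v\<close> is nonzero only if \<open>u\<close> is the unique edge of \<open>\<sigma>\<close> that meets \<open>v\<close>.\<close>
  have pt: "(if v \<in> link V \<epsilon> \<sigma> then 0 else 1) + (\<Sum>u\<in>\<sigma>. N u v) \<le> (\<Sum>u\<in>\<sigma>. M u v)"
    if v: "v \<in> V" for v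
  proof (cases "v \<in> link V \<epsilon> \<sigma>")
    case True
    then have "(\<Sum>u\<in>\<sigma>. N u v) = 0" by (intro sum.neutral) (auto simp: N_def link_def)
    with True show ?thesis by (simp add: sum_nonneg M_nonneg)
  next
    case False
    show ?thesis
    proof (cases "\<exists>u\<in>\<sigma>. v \<in> link V \<epsilon> (\<sigma> - {u}) \<and> \<epsilon> u \<inter> \<epsilon> v \<noteq> {}")
      case True
      then obtain u where u: "u \<in> \<sigma>" "v \<in> link V \<epsilon> (\<sigma> - {u})" "\<epsilon> u \<inter> \<epsilon> v \<noteq> {}" by blast
      have "(\<Sum>u'\<in>\<sigma> - {u}. N u' v) = 0"
        using u by (intro sum.neutral) (auto simp: N_def link_def)
      then have "(\<Sum>u\<in>\<sigma>. N u v) = M u v - 1"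
        using u fin\<sigma> by (simp add: sum.remove[of \<sigma> u] N_def)
      moreover have "M u v \<le> (\<Sum>u\<in>\<sigma>. M u v)"
        by (rule member_le_sum) (use u fin\<sigma> M_nonneg in auto)
      ultimately show ?thesis using False by simp
    next
      case noU: False
      then have "(\<Sum>u\<in>\<sigma>. N u v) = 0" by (intro sum.neutral) (auto simp: N_def)
      moreover obtain u where u: "u \<in> \<sigma>" "\<epsilon> u \<inter> \<epsilon> v \<noteq> {}"
        using False v by (auto simp: link_def)
      have "M u v \<le> (\<Sum>u\<in>\<sigma>. M u v)"
        by (rule member_le_sum) (use u fin\<sigma> M_nonneg in auto)
      ultimately show ?thesis using False M_ge[of u v] u \<sigma>V by auto
    qed
  qed
  have out: "(\<Sum>v\<in>V. w v * (if v \<in> link V \<epsilon> \<sigma> then 0 else 1)) = sum w V - sum w (link V \<epsilon> \<sigma>)"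
  proof -
    have "link V \<epsilon> \<sigma> \<subseteq> V" by (auto simp: link_def)
    then have "sum w V - sum w (link V \<epsilon> \<sigma>) = sum w (V - link V \<epsilon> \<sigma>)"
      using finite_V by (simp add: sum_diff)
    also have "\<dots> = (\<Sum>v\<in>V. w v * (if v \<in> link V \<epsilon> \<sigma> then 0 else 1))"
      by (rule sum.mono_neutral_cong_left) (use finite_V in auto)
    finally show ?thesis by simp
  qed
  have corr: "(\<Sum>v\<in>V. w v * (\<Sum>u\<in>\<sigma>. N u v)) = (\<Sum>u\<in>\<sigma>. \<Sum>v\<in>link V \<epsilon> (\<sigma> - {u}).
        if \<epsilon> u \<inter> \<epsilon> v = {} then 0 else (M u v - 1) * w v)"
  proof -
    have "(\<Sum>v\<in>V. w v * (\<Sum>u\<in>\<sigma>. N u v)) = (\<Sum>u\<in>\<sigma>. \<Sum>v\<in>V. w v * N u v)"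
      unfolding sum_distrib_left by (rule sum.swap)
    also have "\<dots> = (\<Sum>u\<in>\<sigma>. \<Sum>v\<in>link V \<epsilon> (\<sigma> - {u}).
        if \<epsilon> u \<inter> \<epsilon> v = {} then 0 else (M u v - 1) * w v)"
    proof (rule sum.cong[OF refl])
      fix u
      show "(\<Sum>v\<in>V. w v * N u v) = (\<Sum>v\<in>link V \<epsilon> (\<sigma> - {u}).
        if \<epsilon> u \<inter> \<epsilon> v = {} then 0 else (M u v - 1) * w v)"
        by (rule sum.mono_neutral_cong_right) (use finite_V in \<open>auto simp: N_def link_def\<close>)
    qed
    finally show ?thesis .
  qed
  have cover: "(\<Sum>v\<in>V. w v * M u v) \<le> real k" if u: "u \<in> V" for u
  proof -
    have "M u v = (\<Sum>x\<in>\<epsilon> u. if x \<in> \<epsilon> v then 1 else 0)" for v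
      using finite_edge[OF u] by (simp add: M_def sum.inter_restrict[symmetric])
    then have "(\<Sum>v\<in>V. w v * M u v) = (\<Sum>v\<in>V. \<Sum>x\<in>\<epsilon> u. if x \<in> \<epsilon> v then w v else 0)"
      by (simp add: sum_distrib_left if_distrib cong: if_cong)
    also have "\<dots> = (\<Sum>x\<in>\<epsilon> u. \<Sum>v\<in>V. if x \<in> \<epsilon> v then w v else 0)"
      by (rule sum.swap)
    also have "\<dots> = (\<Sum>x\<in>\<epsilon> u. \<Sum>v | v \<in> V \<and> x \<in> \<epsilon> v. w v)"
      by (simp add: sum.inter_filter[OF finite_V])
    also have "\<dots> \<le> (\<Sum>x\<in>\<epsilon> u. 1)"
      by (intro sum_mono fractional)
    finally show ?thesis using uniform[OF u] by simp
  qed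
  have "sum w V - sum w (link V \<epsilon> \<sigma>) + (\<Sum>v\<in>V. w v * (\<Sum>u\<in>\<sigma>. N u v))
      = (\<Sum>v\<in>V. w v * ((if v \<in> link V \<epsilon> \<sigma> then 0 else 1) + (\<Sum>u\<in>\<sigma>. N u v)))"
    unfolding out[symmetric] by (simp only: sum.distrib[symmetric] distrib_left)
  also have "\<dots> \<le> (\<Sum>v\<in>V. w v * (\<Sum>u\<in>\<sigma>. M u v))"
    by (intro sum_mono mult_left_mono pt w_nonneg)
  also have "\<dots> = (\<Sum>u\<in>\<sigma>. \<Sum>v\<in>V. w v * M u v)"
    unfolding sum_distrib_left by (rule sum.swap)
  also have "\<dots> \<le> (\<Sum>u\<in>\<sigma>. real k)"
    by (intro sum_mono cover) (use \<sigma>V in auto)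
  also have "\<dots> = real (k * n)" using card\<sigma> by simp
  finally show ?thesis unfolding corr unfolding M_def by linarith
qed

text \<open>Multiply the identity of \<open>harmonic_pointwise\<close> by
  \<open>\<phi> \<sigma>\<close> and the product weight \<open>W \<sigma>\<close>, then sum. Since
  \<open>W\<close> splits off a factor \<open>w u\<close>, the sum regroups into links, where
  \<open>energy_estimate\<close> applies. The resulting weighted sum of squares is at most 0, while
  \<open>link_weight_bound\<close> and \<open>heavy\<close> make all its coefficients
  positive.\<close>

lemma harmonic_zero:
  fixes w :: "'v \<Rightarrow> real"
  assumes w_pos: "\<And>v. v \<in> V \<Longrightarrow> w v > 0"
    and uniform: "\<And>v. v \<in> V \<Longrightarrow> card (\<epsilon> v) = k"
    and fractional: "\<And>x. (\<Sum>v | v \<in> V \<and> x \<in> \<epsilon> v. w v) \<le> 1"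
    and heavy: "real (k * n) < sum w V"
    and cocycle: "\<And>\<rho>. \<rho> \<in> matchings V \<epsilon> (Suc n) \<Longrightarrow> coboundary r \<phi> \<rho> = 0"
    and cycle: "\<And>p \<eta>. n = Suc p \<Longrightarrow> \<eta> \<in> matchings V \<epsilon> p \<Longrightarrow> (\<Sum>v\<in>link V \<epsilon> \<eta>.
      w v * (order_sign r v \<eta> * \<phi> (insert v \<eta>))) = 0"
    and \<sigma>: "\<sigma> \<in> matchings V \<epsilon> n"
  shows "\<phi> \<sigma> = 0"
proof -
  let ?X = "matchings V \<epsilon> n"
  define a where "a \<eta> u = order_sign r u \<eta> * \<phi> (insert u \<eta>)" for \<eta> u
  define W where "W \<sigma> = prod w \<sigma>" for \<sigma>
  define B where "B \<eta> u = (\<Sum>v\<in>link V \<epsilon> \<eta>.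
      if \<epsilon> u \<inter> \<epsilon> v = {} then 0 else (real (card (\<epsilon> u \<inter> \<epsilon> v)) - 1) * w v)" for \<eta> u
  define E where "E \<eta> u = (\<Sum>v\<in>link V \<epsilon> \<eta>. if \<epsilon> u \<inter> \<epsilon> v = {} then 0 else w v * a \<eta> v)" for \<eta> u
  have pointwise: "sum w (link V \<epsilon> \<sigma>) * \<phi> \<sigma> = - (\<Sum>u\<in>\<sigma>. order_sign r u (\<sigma> - {u}) * E (\<sigma> - {u}) u)"
    if \<sigma>: "\<sigma> \<in> ?X" for \<sigma>
    unfolding E_def a_def
  proof (rule harmonic_pointwise[OF \<sigma> cocycle])
    fix u assume u: "u \<in> \<sigma>"
    then obtain p where p: "n = Suc p"
      using \<sigma> matchings_finite[OF \<sigma>] by (cases n) (auto simp: matchings_def)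
    then show "(\<Sum>v\<in>link V \<epsilon> (\<sigma> - {u}).
      w v * (order_sign r v (\<sigma> - {u}) * \<phi> (insert v (\<sigma> - {u})))) = 0"
      using cycle[OF p] remove_matching(1) \<sigma> u by blast
  qed
  have face: "\<phi> \<sigma> * order_sign r u (\<sigma> - {u}) = a (\<sigma> - {u}) u" "(\<phi> \<sigma>)\<^sup>2 = (a (\<sigma> - {u}) u)\<^sup>2"
    "W \<sigma> = W (\<sigma> - {u}) * w u" if "\<sigma> \<in> ?X" "u \<in> \<sigma>" for \<sigma> u
  proof -
    show "\<phi> \<sigma> * order_sign r u (\<sigma> - {u}) = a (\<sigma> - {u}) u" "(\<phi> \<sigma>)\<^sup>2 = (a (\<sigma> - {u}) u)\<^sup>2"
      using that by (auto simp: a_def insert_absorb power2_eq_square algebra_simps)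
    show "W \<sigma> = W (\<sigma> - {u}) * w u"
      unfolding W_def using that matchings_finite by (subst prod.remove[of \<sigma> u]) auto
  qed
  have energy: "- (\<Sum>\<sigma>\<in>?X. \<Sum>u\<in>\<sigma>. W (\<sigma> - {u}) * (w u * a (\<sigma> - {u}) u * E (\<sigma> - {u}) u))
      \<le> (\<Sum>\<sigma>\<in>?X. \<Sum>u\<in>\<sigma>. W (\<sigma> - {u}) * (w u * (a (\<sigma> - {u}) u)\<^sup>2 * B (\<sigma> - {u}) u))"
  proof (cases n)
    \<comment> \<open>Only the empty matching occurs; it has no codimension-one face, and both sides
      are empty sums.\<close>
    case 0
    then have "(\<Sum>u\<in>\<sigma>. f u) = (0::real)" if "\<sigma> \<in> ?X" for \<sigma> f
      using that matchings_finite[OF that] by (auto simp: matchings_def)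
    then show ?thesis by simp
  next
    case (Suc p)
    have loc: "- (\<Sum>u\<in>link V \<epsilon> \<eta>. w u * a \<eta> u * E \<eta> u)
        \<le> (\<Sum>u\<in>link V \<epsilon> \<eta>. w u * (a \<eta> u)\<^sup>2 * B \<eta> u)" for \<eta>
    proof -
      have "- (\<Sum>u\<in>link V \<epsilon> \<eta>. \<Sum>v\<in>link V \<epsilon> \<eta>.
            if \<epsilon> u \<inter> \<epsilon> v = {} then 0 else w u * a \<eta> u * (w v * a \<eta> v))
          \<le> (\<Sum>u\<in>link V \<epsilon> \<eta>. \<Sum>v\<in>link V \<epsilon> \<eta>. if \<epsilon> u \<inter> \<epsilon> v = {} then 0
              else (real (card (\<epsilon> u \<inter> \<epsilon> v)) - 1) * w u * w v * (a \<eta> u)\<^sup>2)"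
        by (rule energy_estimate)
           (use finite_link finite_edge w_pos in \<open>auto simp: link_def less_imp_le\<close>)
      also have "(\<Sum>u\<in>link V \<epsilon> \<eta>. \<Sum>v\<in>link V \<epsilon> \<eta>.
            if \<epsilon> u \<inter> \<epsilon> v = {} then 0 else w u * a \<eta> u * (w v * a \<eta> v))
          = (\<Sum>u\<in>link V \<epsilon> \<eta>. w u * a \<eta> u * E \<eta> u)"
        unfolding E_def sum_distrib_left by (intro sum.cong refl) auto
      also have "(\<Sum>u\<in>link V \<epsilon> \<eta>. \<Sum>v\<in>link V \<epsilon> \<eta>. if \<epsilon> u \<inter> \<epsilon> v = {} then 0
              else (real (card (\<epsilon> u \<inter> \<epsilon> v)) - 1) * w u * w v * (a \<eta> u)\<^sup>2)
          = (\<Sum>u\<in>link V \<epsilon> \<eta>. w u * (a \<eta> u)\<^sup>2 * B \<eta> u)"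
        unfolding B_def sum_distrib_left by (intro sum.cong refl) auto
      finally show ?thesis .
    qed
    have W_nonneg: "W \<eta> \<ge> 0" if "\<eta> \<in> matchings V \<epsilon> p" for \<eta>
      unfolding W_def using that by (intro prod_nonneg) (use w_pos in \<open>force simp: matchings_def less_imp_le\<close>)
    have "- (\<Sum>\<eta>\<in>matchings V \<epsilon> p. \<Sum>u\<in>link V \<epsilon> \<eta>. W \<eta> * (w u * a \<eta> u * E \<eta> u))
        = (\<Sum>\<eta>\<in>matchings V \<epsilon> p. W \<eta> * - (\<Sum>u\<in>link V \<epsilon> \<eta>. w u * a \<eta> u * E \<eta> u))"
      by (simp add: sum_distrib_left sum_negf)
    also have "\<dots> \<le> (\<Sum>\<eta>\<in>matchings V \<epsilon> p. W \<eta> * (\<Sum>u\<in>link V \<epsilon> \<eta>. w u * (a \<eta> u)\<^sup>2 * B \<eta> u))"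
      by (intro sum_mono mult_left_mono loc W_nonneg)
    also have "\<dots> = (\<Sum>\<eta>\<in>matchings V \<epsilon> p. \<Sum>u\<in>link V \<epsilon> \<eta>. W \<eta> * (w u * (a \<eta> u)\<^sup>2 * B \<eta> u))"
      by (simp add: sum_distrib_left)
    finally show ?thesis
      unfolding Suc by (simp only: sum_matchings_Suc[where f = "\<lambda>\<eta> u. W \<eta> * (w u * a \<eta> u * E \<eta> u)"]
        sum_matchings_Suc[where f = "\<lambda>\<eta> u. W \<eta> * (w u * (a \<eta> u)\<^sup>2 * B \<eta> u)"])
  qed
  have lhs: "W \<sigma> * (\<phi> \<sigma>)\<^sup>2 * sum w (link V \<epsilon> \<sigma>)
      = - (\<Sum>u\<in>\<sigma>. W (\<sigma> - {u}) * (w u * a (\<sigma> - {u}) u * E (\<sigma> - {u}) u))" if "\<sigma> \<in> ?X" for \<sigma>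
  proof -
    have "W \<sigma> * (\<phi> \<sigma>)\<^sup>2 * sum w (link V \<epsilon> \<sigma>) = W \<sigma> * \<phi> \<sigma> * (sum w (link V \<epsilon> \<sigma>) * \<phi> \<sigma>)"
      by (simp add: power2_eq_square)
    also have "\<dots> = - (\<Sum>u\<in>\<sigma>. W \<sigma> * (\<phi> \<sigma> * order_sign r u (\<sigma> - {u})) * E (\<sigma> - {u}) u)"
      unfolding pointwise[OF that] by (simp add: sum_distrib_left mult.assoc)
    also have "\<dots> = - (\<Sum>u\<in>\<sigma>. W (\<sigma> - {u}) * (w u * a (\<sigma> - {u}) u * E (\<sigma> - {u}) u))"
      by (intro arg_cong[where f = uminus] sum.cong refl)
         (simp only: face(1,3)[OF that] mult.assoc)
    finally show ?thesis .
  qed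
  have rhs: "W \<sigma> * (\<phi> \<sigma>)\<^sup>2 * (\<Sum>u\<in>\<sigma>. B (\<sigma> - {u}) u)
      = (\<Sum>u\<in>\<sigma>. W (\<sigma> - {u}) * (w u * (a (\<sigma> - {u}) u)\<^sup>2 * B (\<sigma> - {u}) u))" if "\<sigma> \<in> ?X" for \<sigma>
    unfolding sum_distrib_left
    by (intro sum.cong refl) (simp only: face(2,3)[OF that] mult.assoc)
  have "(\<Sum>\<sigma>\<in>?X. W \<sigma> * (\<phi> \<sigma>)\<^sup>2 * (sum w (link V \<epsilon> \<sigma>) - (\<Sum>u\<in>\<sigma>. B (\<sigma> - {u}) u))) \<le> 0"
    using energy by (simp add: right_diff_distrib sum_subtractf lhs rhs sum_negf)
  moreover have bracket: "sum w (link V \<epsilon> \<sigma>) - (\<Sum>u\<in>\<sigma>. B (\<sigma> - {u}) u) > 0" if "\<sigma> \<in> ?X" for \<sigma>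
    using link_weight_bound[OF that _ uniform fractional] heavy w_pos
    unfolding B_def by (smt (verit, best))
  moreover have W_pos: "W \<sigma> > 0" if "\<sigma> \<in> ?X" for \<sigma>
    unfolding W_def using that w_pos by (intro prod_pos) (auto simp: matchings_def)
  ultimately have "\<forall>\<sigma>\<in>?X. W \<sigma> * (\<phi> \<sigma>)\<^sup>2 * (sum w (link V \<epsilon> \<sigma>) - (\<Sum>u\<in>\<sigma>. B (\<sigma> - {u}) u)) = 0"
    by (subst sum_nonneg_eq_0_iff[symmetric])
       (auto intro!: antisym sum_nonneg mult_nonneg_nonneg finite_matchings simp: less_imp_le)
  with \<sigma> bracket[OF \<sigma>] W_pos[OF \<sigma>] show ?thesis by force
qed

text \<open>Subtract from \<open>z\<close> its projection onto the boundaries. The remainder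
  \<open>h\<close> is still a cycle and is orthogonal to all boundaries, so after rescaling it is
  harmonic and vanishes by \<open>harmonic_zero\<close>.\<close>

theorem cycle_is_boundary:
  fixes w :: "'v \<Rightarrow> real"
  assumes w_pos: "\<And>v. v \<in> V \<Longrightarrow> w v > 0"
    and uniform: "\<And>v. v \<in> V \<Longrightarrow> card (\<epsilon> v) = k"
    and fractional: "\<And>x. (\<Sum>v | v \<in> V \<and> x \<in> \<epsilon> v. w v) \<le> 1"
    and heavy: "real (k * n) < sum w V"
    and supp: "\<And>\<sigma>. z \<sigma> \<noteq> 0 \<Longrightarrow> \<sigma> \<in> matchings V \<epsilon> n"
    and cycle: "\<And>\<tau>. boundary r V z \<tau> = 0"
  shows "\<exists>y. (\<forall>\<sigma>. y \<sigma> \<noteq> 0 \<longrightarrow> \<sigma> \<in> matchings V \<epsilon> (Suc n)) \<and> (\<forall>\<tau>. boundary r V y \<tau> = z \<tau>)"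
proof -
  let ?X = "matchings V \<epsilon> n" and ?Y = "matchings V \<epsilon> (Suc n)"
  define W where "W \<sigma> = prod w \<sigma>" for \<sigma>
  have W_pos: "W \<sigma> > 0" if "\<sigma> \<in> matchings V \<epsilon> q" for \<sigma> q
    unfolding W_def using that w_pos by (intro prod_pos) (auto simp: matchings_def)
  \<comment> \<open>\<open>g \<rho>\<close> is the boundary of the elementary chain that is 1 on
    \<open>\<rho>\<close> and 0 elsewhere.\<close>
  define g where "g \<rho> \<tau> = (\<Sum>v\<in>\<rho>. if \<tau> = \<rho> - {v} then order_sign r v \<tau> else 0)" for \<rho> \<tau>
  obtain y0 where y0: "\<forall>\<rho>\<in>?Y. (\<Sum>\<tau>\<in>?X. 1 / W \<tau> * (z \<tau> - (\<Sum>\<rho>'\<in>?Y. y0 \<rho>' * g \<rho>' \<tau>)) * g \<rho> \<tau>) = 0"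
    using ex_weighted_projection[OF finite_matchings finite_matchings, of n "\<lambda>\<tau>. 1 / W \<tau>" "Suc n" z g]
      W_pos by auto
  define y where "y \<rho> = (if \<rho> \<in> ?Y then y0 \<rho> else 0)" for \<rho>
  have y_supp: "y \<rho> \<noteq> 0 \<Longrightarrow> \<rho> \<in> ?Y" for \<rho> by (auto simp: y_def split: if_splits)
  define h where "h \<tau> = z \<tau> - boundary r V y \<tau>" for \<tau>
  have h_supp: "\<tau> \<in> ?X" if "h \<tau> \<noteq> 0" for \<tau>
  proof (rule ccontr)
    assume "\<tau> \<notin> ?X"
    with boundary_outside_matchings[OF y_supp this] supp that show False
      by (auto simp: h_def)
  qed
  have bd_y: "boundary r V y \<tau> = (\<Sum>\<rho>\<in>?Y. y0 \<rho> * g \<rho> \<tau>)" if \<tau>: "\<tau> \<in> ?X" for \<tau>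
  proof -
    have "(\<Sum>\<rho>\<in>?Y. y0 \<rho> * g \<rho> \<tau>)
        = (\<Sum>\<rho>\<in>?Y. \<Sum>v\<in>\<rho>. if \<tau> = \<rho> - {v} then order_sign r v (\<rho> - {v}) * y0 (insert v (\<rho> - {v})) else 0)"
      unfolding g_def sum_distrib_left by (intro sum.cong refl) (auto simp: insert_absorb)
    also have "\<dots> = (\<Sum>\<eta>\<in>?X. \<Sum>v\<in>link V \<epsilon> \<eta>. if \<tau> = \<eta> then order_sign r v \<eta> * y0 (insert v \<eta>) else 0)"
      by (rule sum_matchings_Suc)
    also have "\<dots> = (\<Sum>\<eta>\<in>?X. if \<tau> = \<eta> then (\<Sum>v\<in>link V \<epsilon> \<eta>. order_sign r v \<eta> * y0 (insert v \<eta>)) else 0)"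
      by (intro sum.cong refl) auto
    also have "\<dots> = (\<Sum>v\<in>link V \<epsilon> \<tau>. order_sign r v \<tau> * y0 (insert v \<tau>))"
      using \<tau> by (simp add: finite_matchings)
    also have "\<dots> = (\<Sum>v\<in>link V \<epsilon> \<tau>. order_sign r v \<tau> * y (insert v \<tau>))"
      by (intro sum.cong refl) (simp add: y_def insert_link[OF \<tau>])
    also have "\<dots> = boundary r V y \<tau>"
      by (rule boundary_eq_sum_link[OF y_supp \<tau>, symmetric])
    finally show ?thesis by simp
  qed
  \<comment> \<open>The projection uses weights \<open>1 / W \<tau>\<close>. Dividing
    \<open>h\<close> by \<open>W\<close> therefore turns orthogonality into the unweighted cocycle
    condition and moves the weights into the cycle condition.\<close>
  define \<phi> where "\<phi> \<tau> = h \<tau> / W \<tau>" for \<tau>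
  have cocycle_\<phi>: "coboundary r \<phi> \<rho> = 0" if \<rho>: "\<rho> \<in> ?Y" for \<rho>
  proof -
    have "0 = (\<Sum>\<tau>\<in>?X. 1 / W \<tau> * (z \<tau> - (\<Sum>\<rho>'\<in>?Y. y0 \<rho>' * g \<rho>' \<tau>)) * g \<rho> \<tau>)"
      using y0 \<rho> by simp
    also have "\<dots> = (\<Sum>\<tau>\<in>?X. \<phi> \<tau> * g \<rho> \<tau>)"
      by (intro sum.cong refl) (simp add: \<phi>_def h_def bd_y)
    also have "\<dots> = (\<Sum>\<tau>\<in>?X. \<Sum>v\<in>\<rho>. if \<tau> = \<rho> - {v} then order_sign r v (\<rho> - {v}) * \<phi> (\<rho> - {v}) else 0)"
      unfolding g_def sum_distrib_left by (intro sum.cong refl) auto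
    also have "\<dots> = (\<Sum>v\<in>\<rho>. \<Sum>\<tau>\<in>?X. if \<tau> = \<rho> - {v} then order_sign r v (\<rho> - {v}) * \<phi> (\<rho> - {v}) else 0)"
      by (rule sum.swap)
    also have "\<dots> = coboundary r \<phi> \<rho>"
      unfolding coboundary_def
      by (intro sum.cong refl) (simp add: finite_matchings remove_matching[OF \<rho>])
    finally show ?thesis by simp
  qed
  have cycle_\<phi>: "(\<Sum>v\<in>link V \<epsilon> \<eta>. w v * (order_sign r v \<eta> * \<phi> (insert v \<eta>))) = 0"
    if n: "n = Suc p" and \<eta>: "\<eta> \<in> matchings V \<epsilon> p" for p \<eta>
  proof -
    have "boundary r V h \<eta> = boundary r V z \<eta> - boundary r V (boundary r V y) \<eta>"
      by (simp add: boundary_def h_def right_diff_distrib sum_subtractf)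
    also have "\<dots> = 0"
      using cycle boundary_boundary[OF finite_V matchings_finite[OF \<eta>] inj_r] by simp
    finally have "0 = (\<Sum>v\<in>link V \<epsilon> \<eta>. order_sign r v \<eta> * h (insert v \<eta>))"
      using boundary_eq_sum_link[of h p \<eta>] h_supp n \<eta> by simp
    also have "\<dots> = (\<Sum>v\<in>link V \<epsilon> \<eta>. W \<eta> * (w v * (order_sign r v \<eta> * \<phi> (insert v \<eta>))))"
    proof (rule sum.cong[OF refl])
      fix v assume v: "v \<in> link V \<epsilon> \<eta>"
      \<comment> \<open>The common factor \<open>W \<eta>\<close> cancels at the end, leaving only
        the weight \<open>w v\<close> that \<open>harmonic_zero\<close> expects.\<close>
      have "W (insert v \<eta>) = w v * W \<eta>"
        using insert_link[OF \<eta> v] matchings_finite[OF \<eta>] by (simp add: W_def)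
      moreover have "w v > 0" "W \<eta> > 0" using v w_pos W_pos[OF \<eta>] by (auto simp: link_def)
      ultimately show "order_sign r v \<eta> * h (insert v \<eta>)
          = W \<eta> * (w v * (order_sign r v \<eta> * \<phi> (insert v \<eta>)))"
        by (simp add: \<phi>_def)
    qed
    finally show ?thesis using W_pos[OF \<eta>] by (simp add: sum_distrib_left[symmetric])
  qed
  have "h \<tau> = 0" for \<tau>
  proof (rule ccontr)
    assume "h \<tau> \<noteq> 0"
    then have \<tau>: "\<tau> \<in> ?X" by (rule h_supp)
    have "\<phi> \<tau> = 0"
      by (rule harmonic_zero[OF w_pos uniform fractional heavy cocycle_\<phi> cycle_\<phi> \<tau>])
    with \<open>h \<tau> \<noteq> 0\<close> W_pos[OF \<tau>] show False by (simp add: \<phi>_def)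
  qed
  then show ?thesis using y_supp by (intro exI[of _ y]) (simp add: h_def)
qed

end

section \<open>Rainbow sets and the pushforward of chains along a colouring\<close>

definition rainbow :: "'v set \<Rightarrow> ('v \<Rightarrow> nat) \<Rightarrow> nat set \<Rightarrow> 'v set set" where
  "rainbow V c J = {\<sigma>. \<sigma> \<subseteq> V \<and> inj_on c \<sigma> \<and> c ` \<sigma> = J}"

lemma finite_rainbow: "finite V \<Longrightarrow> finite (rainbow V c J)"
  by (rule finite_subset[of _ "Pow V"]) (auto simp: rainbow_def)

text \<open>The order \<open>r\<close> refines the order of the colours, so the colouring preserves
  order and counting predecessors gives the same number before and after applying it.\<close>

lemma order_sign_colour:
  assumes mono: "\<And>u v. u \<in> V \<Longrightarrow> v \<in> V \<Longrightarrow> c u < c v \<Longrightarrow> r u < r v"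
    and \<tau>: "\<tau> \<subseteq> V" "inj_on c \<tau>" and v: "v \<in> V" "c v \<notin> c ` \<tau>"
  shows "order_sign r v \<tau> = order_sign id (c v) (c ` \<tau>)"
proof -
  have iff: "r x < r v \<longleftrightarrow> c x < c v" if "x \<in> \<tau>" for x
  proof -
    have "c x \<noteq> c v" "x \<in> V" using that v(2) \<tau>(1) by (metis imageI, blast)
    then show ?thesis using mono[of x v] mono[of v x] v(1) by (meson linorder_neqE_nat order_less_asym)
  qed
  have "{j \<in> c ` \<tau>. j < c v} = c ` {x \<in> \<tau>. r x < r v}" using iff by auto
  moreover have "inj_on c {x \<in> \<tau>. r x < r v}" by (rule inj_on_subset[OF \<tau>(2)]) auto
  ultimately show ?thesis by (simp add: order_sign_def card_image)
qed

text \<open>This is the chain map property of the pushforward to the simplex on \<open>I\<close>,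
  read off at the face \<open>I - {i}\<close>. Extensions by a vertex of colour \<open>i\<close>
  give the right side; extensions repeating a colour cancel in pairs.\<close>

lemma sum_rainbow_boundary:
  fixes c r :: "'v \<Rightarrow> nat"
  assumes finV: "finite V" and inj: "inj_on r V"
    and mono: "\<And>u v. u \<in> V \<Longrightarrow> v \<in> V \<Longrightarrow> c u < c v \<Longrightarrow> r u < r v"
    and i: "i \<in> I" and supp: "\<And>\<sigma>. z \<sigma> \<noteq> 0 \<Longrightarrow> c ` \<sigma> \<subseteq> I"
  shows "(\<Sum>\<tau>\<in>rainbow V c (I - {i}). boundary r V z \<tau>)
       = order_sign id i (I - {i}) * (\<Sum>\<sigma>\<in>rainbow V c I. z \<sigma>)"
proof -
  define J where "J = I - {i}"
  define t where "t = (\<lambda>(\<tau>, v). order_sign r v \<tau> * z (insert v \<tau>))"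
  define S where "S = (SIGMA \<tau>:rainbow V c J. V - \<tau>)"
  define A where "A = {p \<in> S. c (snd p) = i}"
  define B where "B = {p \<in> S. c (snd p) \<in> J}"
  have finS: "finite S" unfolding S_def using finV finite_rainbow by blast
  have "(\<Sum>\<tau>\<in>rainbow V c J. boundary r V z \<tau>) = sum t S"
    unfolding boundary_def S_def t_def by (rule sum.Sigma) (use finV finite_rainbow in auto)
  also have "\<dots> = sum t (A \<union> B)"
  proof (rule sum.mono_neutral_right)
    \<comment> \<open>The remaining pairs add a colour outside \<open>I\<close>, where
      \<open>z\<close> vanishes.\<close>
    show "\<forall>p\<in>S - (A \<union> B). t p = 0"
    proof
      fix p assume p: "p \<in> S - (A \<union> B)"
      then have "\<not> c ` insert (snd p) (fst p) \<subseteq> I" by (auto simp: A_def B_def J_def)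
      then have "z (insert (snd p) (fst p)) = 0" using supp by blast
      then show "t p = 0" by (simp add: t_def split_beta)
    qed
  qed (use finS in \<open>auto simp: A_def B_def\<close>)
  also have "\<dots> = sum t A + sum t B"
    by (rule sum.union_disjoint) (use finS in \<open>auto simp: A_def B_def J_def\<close>)
  also have "sum t A = (\<Sum>\<sigma>\<in>rainbow V c I. order_sign id i J * z \<sigma>)"
  \<comment> \<open>A rainbow set with colours \<open>I\<close> has a unique vertex of colour
    \<open>i\<close>; removing it inverts the insertion.\<close>
  proof (rule sum.reindex_bij_witness[of _
        "\<lambda>\<sigma>. (\<sigma> - {the_inv_into \<sigma> c i}, the_inv_into \<sigma> c i)" "\<lambda>(\<tau>, v). insert v \<tau>"])
    fix p assume p: "p \<in> A"
    obtain \<tau> v where [simp]: "p = (\<tau>, v)" by force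
    have \<tau>: "\<tau> \<subseteq> V" "inj_on c \<tau>" "c ` \<tau> = J" "v \<in> V" "v \<notin> \<tau>" "c v = i"
      using p by (auto simp: A_def S_def rainbow_def)
    have "c v \<notin> c ` \<tau>" using \<tau> by (auto simp: J_def)
    then have inj': "inj_on c (insert v \<tau>)" using \<tau> by (auto simp: inj_on_insert)
    have the: "the_inv_into (insert v \<tau>) c i = v"
      using the_inv_into_f_f[OF inj', of v] \<tau> by simp
    show "(\<lambda>\<sigma>. (\<sigma> - {the_inv_into \<sigma> c i}, the_inv_into \<sigma> c i)) ((\<lambda>(\<tau>, v). insert v \<tau>) p) = p"
      using the \<tau> by simp
    show "(\<lambda>(\<tau>, v). insert v \<tau>) p \<in> rainbow V c I"
      using inj' \<tau> i by (auto simp: rainbow_def J_def)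
    have "order_sign r v \<tau> = order_sign id i J"
      using order_sign_colour[OF mono \<tau>(1,2,4) \<open>c v \<notin> c ` \<tau>\<close>] \<tau> by simp
    then show "order_sign id i J * z ((\<lambda>(\<tau>, v). insert v \<tau>) p) = t p" by (simp add: t_def)
  next
    fix \<sigma> assume \<sigma>: "\<sigma> \<in> rainbow V c I"
    then have inj\<sigma>: "inj_on c \<sigma>" and im: "c ` \<sigma> = I" and sub: "\<sigma> \<subseteq> V" by (auto simp: rainbow_def)
    define v where "v = the_inv_into \<sigma> c i"
    have v: "v \<in> \<sigma>" "c v = i"
      using the_inv_into_into[OF inj\<sigma>, of i \<sigma>] f_the_inv_into_f[OF inj\<sigma>, of i] im i
      by (auto simp: v_def)
    have "c ` (\<sigma> - {v}) = J"
      using inj_on_image_set_diff[OF inj\<sigma>, of \<sigma> "{v}"] v im by (auto simp: J_def)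
    then have "(\<sigma> - {v}, v) \<in> A"
      using v sub inj\<sigma> by (auto simp: A_def S_def rainbow_def intro: inj_on_subset)
    then show "(\<sigma> - {the_inv_into \<sigma> c i}, the_inv_into \<sigma> c i) \<in> A"
      by (simp only: v_def)
    show "(\<lambda>(\<tau>, v). insert v \<tau>) (\<sigma> - {the_inv_into \<sigma> c i}, the_inv_into \<sigma> c i) = \<sigma>"
      using v by (simp add: v_def[symmetric] insert_absorb)
  qed
  \<comment> \<open>Exchanging \<open>v\<close> with the vertex of \<open>\<tau>\<close> of the same colour reverses the sign, because the two
    are adjacent in the order on \<open>insert v \<tau>\<close>.\<close>
  also have "sum t B = 0"
  proof -
    define F where "F = (\<lambda>(\<tau>, v). (insert v (\<tau> - {the_inv_into \<tau> c (c v)}), the_inv_into \<tau> c (c v)))"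
    have F: "F (F p) = p \<and> F p \<in> B \<and> t (F p) = - t p" if p: "p \<in> B" for p
    proof -
      obtain \<tau> v where [simp]: "p = (\<tau>, v)" by force
      have \<tau>: "\<tau> \<subseteq> V" "inj_on c \<tau>" "c ` \<tau> = J" "v \<in> V" "v \<notin> \<tau>" "c v \<in> J"
        using p by (auto simp: B_def S_def rainbow_def)
      define u where "u = the_inv_into \<tau> c (c v)"
      have u: "u \<in> \<tau>" "c u = c v"
        using the_inv_into_into[OF \<tau>(2), of "c v" \<tau>] f_the_inv_into_f[OF \<tau>(2), of "c v"] \<tau>
        by (auto simp: u_def)
      define \<eta> where "\<eta> = \<tau> - {u}"
      have \<eta>: "\<tau> = insert u \<eta>" "u \<notin> \<eta>" "v \<notin> \<eta>" "u \<noteq> v" "\<eta> \<subseteq> V" "u \<in> V" "finite \<eta>"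
        using u \<tau> finite_subset[OF \<tau>(1) finV] by (auto simp: \<eta>_def)
      have inj\<eta>: "inj_on c \<eta>" and cu: "c u \<notin> c ` \<eta>"
        using \<tau>(2) \<eta>(1,2) by (auto simp: inj_on_insert)
      have inj': "inj_on c (insert v \<eta>)" using inj\<eta> cu u(2) by (auto simp: inj_on_insert)
      have Fp: "F p = (insert v \<eta>, u)"
        by (simp add: F_def u_def[symmetric] \<eta>_def)
      have "the_inv_into (insert v \<eta>) c (c u) = v"
        using the_inv_into_f_f[OF inj', of v] u by simp
      then have FF: "F (F p) = p"
        unfolding Fp using \<eta> by (simp add: F_def)
      have mem: "F p \<in> B"
        unfolding Fp using \<eta> \<tau> inj' u by (auto simp: B_def S_def rainbow_def)
      have eq: "order_sign r v \<eta> = order_sign r u \<eta>"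
        using order_sign_colour[OF mono \<eta>(5) inj\<eta> \<tau>(4)]
          order_sign_colour[OF mono \<eta>(5) inj\<eta> \<eta>(6)] cu u by simp
      have "r u \<noteq> r v" using inj \<eta> \<tau> by (auto dest: inj_onD)
      then have "order_sign r u (insert v \<eta>) = - order_sign r v (insert u \<eta>)"
        using \<eta> eq by (auto simp: order_sign_insert)
      then have "t (F p) = - t p"
        unfolding Fp using \<eta>(1) by (simp add: t_def insert_commute)
      with FF mem show ?thesis by blast
    qed
    have "sum t B = (\<Sum>p\<in>B. - t p)"
      by (rule sum.reindex_bij_witness[of _ F F]) (use F in auto)
    then show ?thesis by (simp add: sum_negf)
  qed
  finally show ?thesis by (simp only: J_def sum_distrib_left add_0_right)
qed

section \<open>Chains filled in over colour sets, and the existence of a rainbow matching\<close>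

lemma coboundary_cong:
  "(\<And>v. v \<in> \<rho> \<Longrightarrow> f (\<rho> - {v}) = g (\<rho> - {v})) \<Longrightarrow> coboundary r f \<rho> = coboundary r g \<rho>"
  by (simp add: coboundary_def)

lemma matchings_mono: "A \<subseteq> V \<Longrightarrow> matchings A \<epsilon> n \<subseteq> matchings V \<epsilon> n"
  by (auto simp: matchings_def)

context hyperedge_family
begin

text \<open>An acyclic carrier argument: the faces of the simplex on \<open>M\<close> are sent to
  chains of matchings, dimension by dimension, and \<open>heavy\<close> supplies the exactness
  needed on the hyperedges with colours in \<open>I\<close>. Composed with the colouring, this map
  preserves the coefficient 1, so the top chain meets a rainbow set.\<close>

theorem ex_rainbow_matching:
  fixes w :: "'v \<Rightarrow> real" and c :: "'v \<Rightarrow> nat"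
  assumes finM: "finite M"
    and mono: "\<And>u v. u \<in> V \<Longrightarrow> v \<in> V \<Longrightarrow> c u < c v \<Longrightarrow> r u < r v"
    and w_pos: "\<And>v. v \<in> V \<Longrightarrow> w v > 0"
    and uniform: "\<And>v. v \<in> V \<Longrightarrow> card (\<epsilon> v) = k"
    and fractional: "\<And>x. (\<Sum>v | v \<in> V \<and> x \<in> \<epsilon> v. w v) \<le> 1"
    and heavy: "\<And>I. I \<subseteq> M \<Longrightarrow> I \<noteq> {} \<Longrightarrow> real (k * (card I - 1)) < sum w {v \<in> V. c v \<in> I}"
  shows "\<exists>\<sigma>\<in>rainbow V c M. disjoint_family_on \<epsilon> \<sigma>"
proof -
  define U where "U I = {v \<in> V. c v \<in> I}" for I
  \<comment> \<open>The coboundary acts on the colour set: the boundary of \<open>\<phi> I\<close>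
    is the alternating sum of the chains on the facets of \<open>I\<close>. The last clause
    normalises the map at the empty face.\<close>
  define P where "P \<phi> I \<longleftrightarrow> (\<forall>\<sigma>. \<phi> I \<sigma> \<noteq> 0 \<longrightarrow> \<sigma> \<in> matchings (U I) \<epsilon> (card I))
      \<and> (\<forall>\<tau>. boundary r V (\<phi> I) \<tau> = coboundary id (\<lambda>J. \<phi> J \<tau>) I)
      \<and> (I = {} \<longrightarrow> \<phi> I {} = 1)" for \<phi> :: "nat set \<Rightarrow> 'v set \<Rightarrow> real" and I
  have ex: "\<exists>\<phi>. \<forall>I. I \<subseteq> M \<longrightarrow> card I \<le> n \<longrightarrow> P \<phi> I" for n
  proof (induction n)
    case 0
    have "P (\<lambda>I \<sigma>. if \<sigma> = {} then 1 else 0) {}"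
      by (auto simp: P_def matchings_def disjoint_family_on_def boundary_def coboundary_def
          split: if_splits)
    moreover have "I = {}" if "I \<subseteq> M" "card I \<le> 0" for I
      using that finM by (auto dest: finite_subset)
    ultimately show ?case by metis
  next
    case (Suc n)
    then obtain \<phi> where \<phi>: "\<And>I. I \<subseteq> M \<Longrightarrow> card I \<le> n \<Longrightarrow> P \<phi> I" by blast
    have "\<exists>y. (\<forall>\<sigma>. y \<sigma> \<noteq> 0 \<longrightarrow> \<sigma> \<in> matchings (U I) \<epsilon> (Suc n))
        \<and> (\<forall>\<tau>. boundary r V y \<tau> = coboundary id (\<lambda>J. \<phi> J \<tau>) I)"
      if I: "I \<subseteq> M" "card I = Suc n" for I
    proof -
      have finI: "finite I" using I by (simp add: card_ge_0_finite)
      have UV: "U I \<subseteq> V" by (auto simp: U_def)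
      interpret A: hyperedge_family "U I" \<epsilon> r
      proof
        show "finite (U I)" "inj_on r (U I)"
          using finite_subset[OF UV finite_V] inj_on_subset[OF inj_r UV] by this
        show "finite (\<epsilon> v)" "\<epsilon> v \<noteq> {}" if "v \<in> U I" for v
          using finite_edge edge_nonempty UV that by blast+
      qed
      have face: "P \<phi> (I - {i})" "card (I - {i}) = n" if "i \<in> I" for i
        using that I finI by (auto intro!: \<phi>)
      \<comment> \<open>\<open>z\<close> is the prescribed boundary of the chain sought for
        \<open>I\<close>. It is a cycle because the boundaries of the facet chains turn it into a
        double coboundary.\<close>
      define z where "z \<tau> = coboundary id (\<lambda>J. \<phi> J \<tau>) I" for \<tau>
      have supp: "\<tau> \<in> matchings (U I) \<epsilon> n" if "z \<tau> \<noteq> 0" for \<tau>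
      proof -
        have "\<exists>i\<in>I. \<phi> (I - {i}) \<tau> \<noteq> 0"
        proof (rule ccontr)
          assume "\<not> ?thesis"
          then have "z \<tau> = 0" unfolding z_def coboundary_def by (intro sum.neutral) auto
          with that show False by simp
        qed
        then obtain i where i: "i \<in> I" "\<phi> (I - {i}) \<tau> \<noteq> 0" by blast
        then have "\<tau> \<in> matchings (U (I - {i})) \<epsilon> n" using face[OF i(1)] by (auto simp: P_def)
        moreover have "U (I - {i}) \<subseteq> U I" by (auto simp: U_def)
        ultimately show ?thesis using matchings_mono by blast
      qed
      \<comment> \<open>Exactness is applied inside \<open>U I\<close>, whereas \<open>P\<close>
        refers to the boundary over \<open>V\<close>; the two agree on chains supported in
        \<open>U I\<close>.\<close>
      have sub: "boundary r V y \<tau> = boundary r (U I) y \<tau>"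
        if "\<And>\<sigma>. y \<sigma> \<noteq> 0 \<Longrightarrow> \<sigma> \<in> matchings (U I) \<epsilon> q" for y q \<tau>
        by (rule boundary_superset[OF finite_V UV]) (use that in \<open>auto simp: matchings_def\<close>)
      have cycle: "boundary r (U I) z \<tau> = 0" for \<tau>
      proof -
        have "boundary r (U I) z \<tau> = boundary r V z \<tau>"
          using sub[OF supp] by simp
        also have "\<dots> = coboundary id (\<lambda>J. boundary r V (\<phi> J) \<tau>) I"
          unfolding z_def by (rule boundary_coboundary_commute[OF finite_V])
        also have "\<dots> = coboundary id (coboundary id (\<lambda>J. \<phi> J \<tau>)) I"
          by (rule coboundary_cong) (use face in \<open>simp add: P_def\<close>)
        also have "\<dots> = 0"
          by (rule coboundary_coboundary[OF finI]) simp
        finally show ?thesis .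
      qed
      \<comment> \<open>The cycle lives on matchings of size \<open>n = card I - 1\<close>, which is
        why \<open>heavy\<close> asks only for \<open>card I - 1\<close>.\<close>
      have "real (k * n) < sum w (U I)"
      proof -
        have "I \<noteq> {}" using I(2) by auto
        then show ?thesis using heavy[OF I(1)] I(2) by (simp add: U_def)
      qed
      moreover have "(\<Sum>v | v \<in> U I \<and> x \<in> \<epsilon> v. w v) \<le> 1" for x
      proof -
        have "(\<Sum>v | v \<in> U I \<and> x \<in> \<epsilon> v. w v) \<le> (\<Sum>v | v \<in> V \<and> x \<in> \<epsilon> v. w v)"
          by (rule sum_mono2) (use finite_V w_pos in \<open>auto simp: U_def less_imp_le\<close>)
        then show ?thesis using fractional[of x] by simp
      qed
      ultimately obtain y where y: "\<forall>\<sigma>. y \<sigma> \<noteq> 0 \<longrightarrow> \<sigma> \<in> matchings (U I) \<epsilon> (Suc n)"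
        "\<forall>\<tau>. boundary r (U I) y \<tau> = z \<tau>"
        using A.cycle_is_boundary[of w k n z] w_pos uniform supp cycle UV by blast
      then show ?thesis using sub[of y "Suc n"] by (auto simp: z_def)
    qed
    then obtain Y where Y: "\<And>I. I \<subseteq> M \<Longrightarrow> card I = Suc n \<Longrightarrow>
        (\<forall>\<sigma>. Y I \<sigma> \<noteq> 0 \<longrightarrow> \<sigma> \<in> matchings (U I) \<epsilon> (Suc n))
        \<and> (\<forall>\<tau>. boundary r V (Y I) \<tau> = coboundary id (\<lambda>J. \<phi> J \<tau>) I)"
      by metis
    \<comment> \<open>Only sets of size \<open>Suc n\<close> are redefined. The coboundary at
      \<open>I\<close> reads proper subsets of \<open>I\<close>, which keep their old
      chains.\<close>
    define \<phi>' where "\<phi>' I = (if card I = Suc n then Y I else \<phi> I)" for I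
    have "P \<phi>' I" if I: "I \<subseteq> M" "card I \<le> Suc n" for I
    proof -
      have finI: "finite I" using I finM finite_subset by blast
      have cob: "coboundary id (\<lambda>J. \<phi>' J \<tau>) I = coboundary id (\<lambda>J. \<phi> J \<tau>) I" for \<tau>
      proof (rule coboundary_cong)
        fix i assume "i \<in> I"
        then have "card (I - {i}) < card I" using finI by (intro psubset_card_mono) auto
        then show "\<phi>' (I - {i}) \<tau> = \<phi> (I - {i}) \<tau>" using I by (simp add: \<phi>'_def)
      qed
      show ?thesis
      proof (cases "card I = Suc n")
        case True
        then show ?thesis using Y[OF I(1) True] cob by (auto simp: P_def \<phi>'_def)
      next
        case False
        then show ?thesis using \<phi>[of I] I cob by (simp add: P_def \<phi>'_def)
      qed
    qed
    then show ?case by blast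
  qed
  from ex[of "card M"] obtain \<phi> where \<phi>: "\<And>I. I \<subseteq> M \<Longrightarrow> P \<phi> I"
    using card_mono[OF finM] by blast
  have supp: "c ` \<sigma> \<subseteq> I" if "I \<subseteq> M" "\<phi> I \<sigma> \<noteq> 0" for I \<sigma>
    using \<phi>[OF that(1)] that(2) by (auto simp: P_def matchings_def U_def)
  \<comment> \<open>By induction on \<open>I\<close>: the boundary relation is summed over the
    rainbow sets of a facet, and the common sign is cancelled.\<close>
  have count: "(\<Sum>\<sigma>\<in>rainbow V c I. \<phi> I \<sigma>) = 1" if "I \<subseteq> M" for I
  proof -
    have "finite I" using that finM finite_subset by blast
    then show ?thesis using that
    proof (induction I rule: finite_induct)
      case empty
      have "rainbow V c {} = {{}}" by (auto simp: rainbow_def)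
      then show ?case using \<phi>[of "{}"] by (simp add: P_def)
    next
      case (insert i J)
      let ?I = "insert i J"
      have J: "?I - {i} = J" using insert.hyps by simp
      have "order_sign id i J * (\<Sum>\<sigma>\<in>rainbow V c ?I. \<phi> ?I \<sigma>)
          = (\<Sum>\<tau>\<in>rainbow V c J. boundary r V (\<phi> ?I) \<tau>)"
        using sum_rainbow_boundary[OF finite_V inj_r mono, where i = i and I = ?I and z = "\<phi> ?I"]
          supp[OF insert.prems] J
        by simp
      also have "\<dots> = (\<Sum>\<tau>\<in>rainbow V c J. order_sign id i J * \<phi> J \<tau>)"
      proof (rule sum.cong[OF refl])
        fix \<tau> assume \<tau>: "\<tau> \<in> rainbow V c J"
        \<comment> \<open>A facet missing a colour \<open>j\<close> of \<open>J\<close> carries only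
          matchings without that colour, while \<open>\<tau>\<close> uses all of \<open>J\<close>.
          Only the facet \<open>J\<close> survives in the coboundary.\<close>
        have z: "\<phi> (?I - {j}) \<tau> = 0" if "j \<in> J" for j
        proof (rule ccontr)
          assume "\<phi> (?I - {j}) \<tau> \<noteq> 0"
          then have "c ` \<tau> \<subseteq> ?I - {j}" using supp[of "?I - {j}"] insert.prems by blast
          with \<tau> that show False by (auto simp: rainbow_def)
        qed
        have "boundary r V (\<phi> ?I) \<tau> = coboundary id (\<lambda>J. \<phi> J \<tau>) ?I"
          using \<phi>[OF insert.prems] by (simp add: P_def)
        also have "\<dots> = order_sign id i J * \<phi> J \<tau>"
          unfolding coboundary_def using insert.hyps J z by simp
        finally show "boundary r V (\<phi> ?I) \<tau> = order_sign id i J * \<phi> J \<tau>" .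
      qed
      also have "\<dots> = order_sign id i J"
        using insert by (simp add: sum_distrib_left[symmetric])
      finally show ?case by (simp add: order_sign_def)
    qed
  qed
  obtain \<sigma> where \<sigma>: "\<sigma> \<in> rainbow V c M" "\<phi> M \<sigma> \<noteq> 0"
    using count[of M] by (metis order_refl sum.neutral zero_neq_one)
  then have "\<sigma> \<in> matchings (U M) \<epsilon> (card M)" using \<phi>[of M] by (auto simp: P_def)
  with \<sigma> show ?thesis by (auto simp: matchings_def)
qed

end

section \<open>Weights from the degree condition, and the disjoint representatives\<close>

theorem theorem5p2:
  fixes k m :: nat
    and H :: "nat \<Rightarrow> 'a set set"
  assumes "k \<ge> 1"
    and "m \<ge> 1"
    and "\<And>i. i \<in> {1..m} \<Longrightarrow> hypergraph (H i)"
    and "\<And>i. i \<in> {1..m} \<Longrightarrow> k_uniform k (H i)"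
    and "\<And>i. i \<in> {1..m} \<Longrightarrow> finite (H i)"
    and "\<And>i. i \<in> {1..m} \<Longrightarrow> H i \<noteq> {}"
    and "\<And>i e. i \<in> {1..m} \<Longrightarrow> e \<in> H i \<Longrightarrow>
      card (H i) \<ge> k * (degree (line_graph (multi_union m H) snd) (i, e) + 1)"
  shows "\<exists>f. is_SJR m H f"
proof -
  let ?V = "multi_union m H" and ?M = "{1..m}"
  have finV: "finite ?V" using assms(5) by (auto simp: multi_union_def)
  have V: "fst v \<in> ?M" "snd v \<in> H (fst v)" if "v \<in> ?V" for v
    using that by (auto simp: multi_union_def)
  have edge: "finite (snd v)" "snd v \<noteq> {}" "card (snd v) = k" if "v \<in> ?V" for v
    using assms(3,4)[OF V(1)[OF that]] V(2)[OF that] by (auto simp: hypergraph_def k_uniform_def)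
  have "finite (snd ` ?V)" using finV by simp
  then obtain g :: "'a set \<Rightarrow> nat" and N where g: "g ` snd ` ?V = {i. i < N}" "inj_on g (snd ` ?V)"
    using finite_imp_inj_to_nat_seg by metis
  \<comment> \<open>This orders copies lexicographically: first by colour, then by the number
    \<open>g\<close> of the hyperedge, which is below \<open>N\<close>. Hence \<open>r\<close> is
    injective and refines the colours.\<close>
  define r where "r v = fst v * N + g (snd v)" for v :: "nat \<times> 'a set"
  have gN: "g (snd v) < N" if "v \<in> ?V" for v using g(1) that by blast
  have mono: "r u < r v" if "u \<in> ?V" "v \<in> ?V" "fst u < fst v" for u v
  proof -
    have "r u < Suc (fst u) * N" using gN[OF that(1)] by (simp add: r_def)
    also have "\<dots> \<le> fst v * N" using that(3) by (intro mult_right_mono) auto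
    finally show ?thesis by (simp add: r_def)
  qed
  have inj: "inj_on r ?V"
  proof (rule inj_onI)
    fix u v assume uv: "u \<in> ?V" "v \<in> ?V" "r u = r v"
    then have "fst u = fst v" using mono[of u v] mono[of v u] by (metis less_irrefl linorder_neqE_nat)
    moreover from this have "g (snd u) = g (snd v)" using uv(3) by (simp add: r_def)
    then have "snd u = snd v" using g(2) uv by (auto dest: inj_onD)
    ultimately show "u = v" by (simp add: prod_eq_iff)
  qed
  interpret hyperedge_family ?V snd r
    by unfold_locales (use finV edge inj in blast)+
  \<comment> \<open>Every colour class receives total weight \<open>k\<close>.\<close>
  define w where "w v = real k / real (card (H (fst v)))" for v :: "nat \<times> 'a set"
  have card_pos: "card (H i) > 0" if "i \<in> ?M" for i
    using assms(5,6)[OF that] by (simp add: card_gt_0_iff)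
  have w_pos: "w v > 0" if "v \<in> ?V" for v
    using card_pos[OF V(1)[OF that]] assms(1) by (simp add: w_def)
  have fractional: "(\<Sum>v | v \<in> ?V \<and> x \<in> snd v. w v) \<le> 1" for x
  proof -
    let ?S = "{v \<in> ?V. x \<in> snd v}"
    \<comment> \<open>All copies through \<open>x\<close> are pairwise adjacent in the line graph,
      so \<open>degree + 1\<close> at \<open>v\<close> is at least \<open>card ?S\<close>, and the
      degree hypothesis bounds the weight.\<close>
    have "w v \<le> 1 / real (card ?S)" if v: "v \<in> ?S" for v
    proof -
      have vV: "v \<in> ?V" using v by simp
      let ?N = "{d \<in> ?V. d \<noteq> v \<and> snd v \<inter> snd d \<noteq> {}}"
      have "card ?S = Suc (card (?S - {v}))"
        using v finV by (intro card.remove) auto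
      also have "card (?S - {v}) \<le> card ?N"
        by (rule card_mono) (use v finV in auto)
      finally have "card ?S \<le> degree (line_graph ?V snd) v + 1"
        by (simp add: degree_line_graph[OF vV])
      then have "k * card ?S \<le> k * (degree (line_graph ?V snd) v + 1)"
        by (rule mult_le_mono2)
      also have "\<dots> \<le> card (H (fst v))"
        using assms(7)[OF V[OF vV]] by simp
      finally have "real k * real (card ?S) \<le> real (card (H (fst v)))"
        by (simp flip: of_nat_mult)
      moreover have "card ?S > 0" using v finV card_gt_0_iff[of ?S] by fastforce
      ultimately show ?thesis
        using card_pos[OF V(1)[OF vV]] by (simp add: w_def field_simps)
    qed
    then have "sum w ?S \<le> (\<Sum>v\<in>?S. 1 / real (card ?S))" by (rule sum_mono)
    also have "\<dots> \<le> 1" by simp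
    finally show ?thesis .
  qed
  \<comment> \<open>The total weight on \<open>I\<close> is \<open>k * card I\<close>, so strictness
    comes from \<open>k \<ge> 1\<close> and the gap of one in \<open>card I - 1\<close>.\<close>
  have heavy: "real (k * (card I - 1)) < sum w {v \<in> ?V. fst v \<in> I}" if I: "I \<subseteq> ?M" "I \<noteq> {}" for I
  proof -
    have finI: "finite I" using I finite_subset by blast
    have "{v \<in> ?V. fst v \<in> I} = (SIGMA i:I. H i)" using I by (auto simp: multi_union_def)
    then have "sum w {v \<in> ?V. fst v \<in> I} = (\<Sum>(i, e)\<in>(SIGMA i:I. H i). w (i, e))" by simp
    also have "\<dots> = (\<Sum>i\<in>I. \<Sum>e\<in>H i. w (i, e))"
      by (rule sum.Sigma[symmetric]) (use I finI assms(5) in auto)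
    also have "\<dots> = (\<Sum>i\<in>I. real k)"
    proof (rule sum.cong[OF refl])
      fix i assume "i \<in> I"
      then show "(\<Sum>e\<in>H i. w (i, e)) = real k" using I card_pos[of i] by (auto simp: w_def)
    qed
    also have "\<dots> = real (k * card I)" by simp
    finally have eq: "sum w {v \<in> ?V. fst v \<in> I} = real (k * card I)" .
    have "k * (card I - 1) < k * card I"
      using assms(1) I finI by (simp add: card_gt_0_iff)
    then show ?thesis unfolding eq by (rule of_nat_less_iff[THEN iffD2])
  qed
  obtain \<sigma> where \<sigma>: "\<sigma> \<in> rainbow ?V fst ?M" "disjoint_family_on snd \<sigma>"
    using ex_rainbow_matching[of ?M fst w k, OF _ mono w_pos edge(3) fractional heavy] by auto
  then have inj\<sigma>: "inj_on fst \<sigma>" and im: "fst ` \<sigma> = ?M" and sub: "\<sigma> \<subseteq> ?V"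
    by (auto simp: rainbow_def)
  define p where "p = the_inv_into \<sigma> fst"
  have p: "p i \<in> \<sigma>" "fst (p i) = i" if "i \<in> ?M" for i
    using the_inv_into_into[OF inj\<sigma>, of i \<sigma>] f_the_inv_into_f[OF inj\<sigma>, of i] im that
    by (auto simp: p_def)
  have "is_SJR m H (\<lambda>i. snd (p i))"
    unfolding is_SJR_def
  proof (intro conjI ballI impI)
    fix i assume i: "i \<in> ?M"
    show "snd (p i) \<in> H i" using V(2)[of "p i"] p[OF i] sub by auto
    fix j assume j: "j \<in> ?M" "i \<noteq> j"
    then have "p i \<noteq> p j" using p[OF i] p[OF j(1)] by metis
    then show "snd (p i) \<inter> snd (p j) = {}"
      using \<sigma>(2) p(1)[OF i] p(1)[OF j(1)] by (auto simp: disjoint_family_on_def)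
  qed
  then show ?thesis by blast
qed

end
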